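(* Let $\mathcal{L}$ be a $4$-dimensional solvable Leibniz algebra over $\mathbb{C}$ whose nilradical is the $3$-dimensional abelian algebra. Then $\mathcal{L}$ is isomorphic to one of the following pairwise non-isomorphic algebras, each with basis $\{x,e_1,e_2,e_3\}$: $\mathcal{L}_{20}(\mu_2,\mu_3)$: $[e_1,x]=e_1$, $[e_2,x]=\mu_2e_2$, $[e_3,x]=\mu_3e_3$, $[x,e_1]=-e_1$, $[x,e_2]=-\mu_2e_2$, $[x,e_3]=-\mu_3e_3$; $\mathcal{L}_{21}(\mu_2,\mu_3)$, $\mu_3\neq0$: $[e_1,x]=e_1$, $[e_2,x]=\mu_2e_2$, $[e_3,x]=\mu_3e_3$, $[x,e_1]=-e_1$, $[x,e_2]=-\mu_2e_2$; $\mathcal{L}_{22}(\mu_2,\mu_3)$, $\mu_2\neq0$, $\mu_3\neq0$: $[e_1,x]=e_1$, $[e_2,x]=\mu_2e_2$, $[e_3,x]=\mu_3e_3$, $[x,e_1]=-e_1$; $\mathcal{L}_{23}(\mu_2,\mu_3)$: $[e_1,x]=e_1$, $[e_2,x]=\mu_2e_2$, $[e_3,x]=\mu_3e_3$; $\mathcal{L}_{24}(\mu_2)$: $[e_1,x]=e_1$, $[e_2,x]=\mu_2e_2$, $[x,e_1]=-e_1$, $[x,e_2]=-\mu_2e_2$, $[x,x]=e_3$; $\mathcal{L}_{25}(\mu_2)$, $\mu_2\neq0$: $[e_1,x]=e_1$, $[e_2,x]=\mu_2e_2$, $[x,e_1]=-e_1$, $[x,x]=e_3$; $\mathcal{L}_{26}(\mu_2)$: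 $[e_1,x]=e_1$, $[e_2,x]=\mu_2e_2$, $[x,x]=e_3$; $\mathcal{L}_{27}$: $[e_1,x]=e_1$, $[x,e_1]=-e_1$, $[x,e_2]=e_3$; $\mathcal{L}_{28}$: $[e_1,x]=e_1$, $[x,e_2]=e_3$; $\mathcal{L}_{29}(\mu_3)$: $[e_1,x]=e_1+e_2$, $[e_2,x]=e_2$, $[e_3,x]=\mu_3e_3$, $[x,e_1]=-e_1-e_2$, $[x,e_2]=-e_2$; $\mathcal{L}_{30}$: $[e_1,x]=e_1+e_2$, $[e_2,x]=e_2$, $[x,e_1]=-e_1-e_2$, $[x,e_2]=-e_2$, $[x,x]=e_3$; $\mathcal{L}_{31}(\mu_3)$, $\mu_3\neq0$: $[e_1,x]=e_1+e_2$, $[e_2,x]=e_2$, $[e_3,x]=\mu_3e_3$, $[x,e_1]=-e_1-e_2$, $[x,e_2]=-e_2$, $[x,e_3]=-\mu_3e_3$; $\mathcal{L}_{32}(\mu_3)$: $[e_1,x]=e_1+e_2$, $[e_2,x]=e_2$, $[e_3,x]=\mu_3e_3$; $\mathcal{L}_{33}$: $[e_1,x]=e_1+e_2$, $[e_2,x]=e_2$, $[x,x]=e_3$; $\mathcal{L}_{34}(\mu_3)$, $\mu_3\neq0$: $[e_1,x]=e_1+e_2$, $[e_2,x]=e_2$, $[e_3,x]=\mu_3e_3$, $[x,e_3]=-\mu_3e_3$; $\mathcal{L}_{35}(\alpha)$: $[e_1,x]=e_2$, $[e_3,x]=e_3$, $[x,e_1]=\alpha e_2$, $[x,e_3]=-e_3$;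 $\mathcal{L}_{36}$: $[e_1,x]=e_2$, $[e_3,x]=e_3$, $[x,e_1]=-e_2$, $[x,e_3]=-e_3$, $[x,x]=e_2$; $\mathcal{L}_{37}$: $[e_1,x]=e_2$, $[e_3,x]=e_3$, $[x,e_3]=-e_3$, $[x,x]=e_1$; $\mathcal{L}_{38}(\alpha)$: $[e_1,x]=e_2$, $[e_3,x]=e_3$, $[x,e_1]=\alpha e_2$; $\mathcal{L}_{39}$: $[e_1,x]=e_2$, $[e_3,x]=e_3$, $[x,e_1]=-e_2$, $[x,x]=e_2$; $\mathcal{L}_{40}$: $[e_1,x]=e_2$, $[e_3,x]=e_3$, $[x,x]=e_1$; $\mathcal{L}_{41}$: $[e_1,x]=e_1+e_2$, $[e_2,x]=e_2+e_3$, $[e_3,x]=e_3$; $\mathcal{L}_{42}$: $[e_1,x]=e_1+e_2$, $[e_2,x]=e_2+e_3$, $[e_3,x]=e_3$, $[x,e_1]=-e_1-e_2$, $[x,e_2]=-e_2-e_3$, $[x,e_3]=-e_3$; where, unless otherwise specified, $\mu_2,\mu_3,\alpha\in\mathbb{C}$ are arbitrary.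
   Context: A (right) Leibniz algebra over $\mathbb{C}$ is a $\mathbb{C}$-vector space $\mathcal{L}$ with a bilinear bracket $[-,-]:\mathcal{L}\times\mathcal{L}\to\mathcal{L}$ satisfying $[x,[y,z]]=[[x,y],z]-[[x,z],y]$ for all $x,y,z\in\mathcal{L}$. All algebras are finite-dimensional over $\mathbb{C}$. Define $\mathcal{L}^1=\mathcal{L}$, $\mathcal{L}^{k+1}=[\mathcal{L}^k,\mathcal{L}]$ and $\mathcal{L}^{[1]}=\mathcal{L}$, $\mathcal{L}^{[s+1]}=[\mathcal{L}^{[s]},\mathcal{L}^{[s]}]$; $\mathcal{L}$ is nilpotent (resp. solvable) if $\mathcal{L}^n=0$ for some $n$ (resp. $\mathcal{L}^{[m]}=0$ for some $m$). The nilradical of $\mathcal{L}$ is its maximal nilpotent (two-sided) ideal. An algebra is abelian if all its products are zero. In multiplication tables, products of basis elements that are not listed are zero.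
   Formalization: "Pairwise non-isomorphic" fails for some parameters within a family, e.g. L20(2,3) ≅ L20(3,2); it is proved up to exactly the parameter changes in L20–L24 and L26 coming from permuting the e_i and rescaling x; distinct families are never isomorphic. *)

theory Defs
  imports "HOL-Analysis.Analysis"
begin

locale leibniz_algebra = vector_space scale
  for scale :: "complex \<Rightarrow> 'a::ab_group_add \<Rightarrow> 'a" +
  fixes bracket :: "'a \<Rightarrow> 'a \<Rightarrow> 'a"
  assumes linear_left: "Vector_Spaces.linear scale scale (\<lambda>x. bracket x y)"
    and linear_right: "Vector_Spaces.linear scale scale (\<lambda>y. bracket x y)"
    and leibniz_identity:
      "bracket x (bracket y z) = bracket (bracket x y) z - bracket (bracket x z) y"
begin

definition set_bracket :: "'a set \<Rightarrow> 'a set \<Rightarrow> 'a set" where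
  "set_bracket A B = span {bracket a b | a b. a \<in> A \<and> b \<in> B}"

(* The series are indexed from 0: \<open>lower_central I k\<close> is the usual I^(k+1) and
   \<open>derived I k\<close> is the usual I^[k+1]. *)
primrec lower_central :: "'a set \<Rightarrow> nat \<Rightarrow> 'a set" where
  "lower_central I 0 = I"
| "lower_central I (Suc k) = set_bracket (lower_central I k) I"

primrec derived :: "'a set \<Rightarrow> nat \<Rightarrow> 'a set" where
  "derived I 0 = I"
| "derived I (Suc k) = set_bracket (derived I k) (derived I k)"

definition nilpotent_set :: "'a set \<Rightarrow> bool" where
  "nilpotent_set I \<longleftrightarrow> (\<exists>k. lower_central I k = {0})"

definition solvable :: bool where
  "solvable \<longleftrightarrow> (\<exists>k. derived UNIV k = {0})"

definition two_sided_ideal :: "'a set \<Rightarrow> bool" where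
  "two_sided_ideal I \<longleftrightarrow>
     subspace I \<and> (\<forall>a\<in>I. \<forall>y. bracket a y \<in> I \<and> bracket y a \<in> I)"

(* In finite dimension a sum of nilpotent ideals is nilpotent, so such an N is unique. *)
definition is_nilradical :: "'a set \<Rightarrow> bool" where
  "is_nilradical N \<longleftrightarrow>
     two_sided_ideal N \<and> nilpotent_set N \<and>
     (\<forall>J. two_sided_ideal J \<and> nilpotent_set J \<and> N \<subseteq> J \<longrightarrow> J = N)"

definition abelian_set :: "'a set \<Rightarrow> bool" where
  "abelian_set I \<longleftrightarrow> (\<forall>a\<in>I. \<forall>b\<in>I. bracket a b = 0)"

end

definition isomorphic_algebras ::
  "(complex \<Rightarrow> 'a::ab_group_add \<Rightarrow> 'a) \<Rightarrow> ('a \<Rightarrow> 'a \<Rightarrow> 'a) \<Rightarrow>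
   (complex \<Rightarrow> 'b::ab_group_add \<Rightarrow> 'b) \<Rightarrow> ('b \<Rightarrow> 'b \<Rightarrow> 'b) \<Rightarrow> bool" where
  "isomorphic_algebras s1 b1 s2 b2 \<longleftrightarrow>
     (\<exists>f. Vector_Spaces.linear s1 s2 f \<and> bij f \<and> (\<forall>u v. f (b1 u v) = b2 (f u) (f v)))"

datatype gen = X | E1 | E2 | E3

lemma UNIV_gen: "UNIV = {X, E1, E2, E3}"
  using gen.exhaust by auto

instance gen :: finite
  by standard (simp add: UNIV_gen)

definition e :: "gen \<Rightarrow> complex ^ gen" where
  "e i = axis i 1"

definition table_bracket ::
  "(gen \<times> gen \<Rightarrow> complex ^ gen) \<Rightarrow> complex ^ gen \<Rightarrow> complex ^ gen \<Rightarrow> complex ^ gen" where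
  "table_bracket T u v = (\<Sum>i\<in>UNIV. \<Sum>j\<in>UNIV. (u $ i * v $ j) *s T (i, j))"

datatype alg =
    L20 complex complex | L21 complex complex | L22 complex complex | L23 complex complex
  | L24 complex | L25 complex | L26 complex
  | L27 | L28
  | L29 complex | L30 | L31 complex | L32 complex | L33 | L34 complex
  | L35 complex | L36 | L37
  | L38 complex | L39 | L40
  | L41 | L42

primrec mult_table :: "alg \<Rightarrow> gen \<times> gen \<Rightarrow> complex ^ gen" where
  "mult_table (L20 \<mu>2 \<mu>3) = (\<lambda>_. 0)
     ((E1, X) := e E1, (E2, X) := \<mu>2 *s e E2, (E3, X) := \<mu>3 *s e E3,
      (X, E1) := - e E1, (X, E2) := - \<mu>2 *s e E2, (X, E3) := - \<mu>3 *s e E3)"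
| "mult_table (L21 \<mu>2 \<mu>3) = (\<lambda>_. 0)
     ((E1, X) := e E1, (E2, X) := \<mu>2 *s e E2, (E3, X) := \<mu>3 *s e E3,
      (X, E1) := - e E1, (X, E2) := - \<mu>2 *s e E2)"
| "mult_table (L22 \<mu>2 \<mu>3) = (\<lambda>_. 0)
     ((E1, X) := e E1, (E2, X) := \<mu>2 *s e E2, (E3, X) := \<mu>3 *s e E3,
      (X, E1) := - e E1)"
| "mult_table (L23 \<mu>2 \<mu>3) = (\<lambda>_. 0)
     ((E1, X) := e E1, (E2, X) := \<mu>2 *s e E2, (E3, X) := \<mu>3 *s e E3)"
| "mult_table (L24 \<mu>2) = (\<lambda>_. 0)
     ((E1, X) := e E1, (E2, X) := \<mu>2 *s e E2,
      (X, E1) := - e E1, (X, E2) := - \<mu>2 *s e E2, (X, X) := e E3)"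
| "mult_table (L25 \<mu>2) = (\<lambda>_. 0)
     ((E1, X) := e E1, (E2, X) := \<mu>2 *s e E2,
      (X, E1) := - e E1, (X, X) := e E3)"
| "mult_table (L26 \<mu>2) = (\<lambda>_. 0)
     ((E1, X) := e E1, (E2, X) := \<mu>2 *s e E2, (X, X) := e E3)"
| "mult_table L27 = (\<lambda>_. 0)
     ((E1, X) := e E1, (X, E1) := - e E1, (X, E2) := e E3)"
| "mult_table L28 = (\<lambda>_. 0)
     ((E1, X) := e E1, (X, E2) := e E3)"
| "mult_table (L29 \<mu>3) = (\<lambda>_. 0)
     ((E1, X) := e E1 + e E2, (E2, X) := e E2, (E3, X) := \<mu>3 *s e E3,
      (X, E1) := - e E1 - e E2, (X, E2) := - e E2)"
| "mult_table L30 = (\<lambda>_. 0)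
     ((E1, X) := e E1 + e E2, (E2, X) := e E2,
      (X, E1) := - e E1 - e E2, (X, E2) := - e E2, (X, X) := e E3)"
| "mult_table (L31 \<mu>3) = (\<lambda>_. 0)
     ((E1, X) := e E1 + e E2, (E2, X) := e E2, (E3, X) := \<mu>3 *s e E3,
      (X, E1) := - e E1 - e E2, (X, E2) := - e E2, (X, E3) := - \<mu>3 *s e E3)"
| "mult_table (L32 \<mu>3) = (\<lambda>_. 0)
     ((E1, X) := e E1 + e E2, (E2, X) := e E2, (E3, X) := \<mu>3 *s e E3)"
| "mult_table L33 = (\<lambda>_. 0)
     ((E1, X) := e E1 + e E2, (E2, X) := e E2, (X, X) := e E3)"
| "mult_table (L34 \<mu>3) = (\<lambda>_. 0)
     ((E1, X) := e E1 + e E2, (E2, X) := e E2, (E3, X) := \<mu>3 *s e E3,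
      (X, E3) := - \<mu>3 *s e E3)"
| "mult_table (L35 \<alpha>) = (\<lambda>_. 0)
     ((E1, X) := e E2, (E3, X) := e E3, (X, E1) := \<alpha> *s e E2, (X, E3) := - e E3)"
| "mult_table L36 = (\<lambda>_. 0)
     ((E1, X) := e E2, (E3, X) := e E3, (X, E1) := - e E2, (X, E3) := - e E3,
      (X, X) := e E2)"
| "mult_table L37 = (\<lambda>_. 0)
     ((E1, X) := e E2, (E3, X) := e E3, (X, E3) := - e E3, (X, X) := e E1)"
| "mult_table (L38 \<alpha>) = (\<lambda>_. 0)
     ((E1, X) := e E2, (E3, X) := e E3, (X, E1) := \<alpha> *s e E2)"
| "mult_table L39 = (\<lambda>_. 0)
     ((E1, X) := e E2, (E3, X) := e E3, (X, E1) := - e E2, (X, X) := e E2)"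
| "mult_table L40 = (\<lambda>_. 0)
     ((E1, X) := e E2, (E3, X) := e E3, (X, X) := e E1)"
| "mult_table L41 = (\<lambda>_. 0)
     ((E1, X) := e E1 + e E2, (E2, X) := e E2 + e E3, (E3, X) := e E3)"
| "mult_table L42 = (\<lambda>_. 0)
     ((E1, X) := e E1 + e E2, (E2, X) := e E2 + e E3, (E3, X) := e E3,
      (X, E1) := - e E1 - e E2, (X, E2) := - e E2 - e E3, (X, E3) := - e E3)"

fun admissible :: "alg \<Rightarrow> bool" where
  "admissible (L21 \<mu>2 \<mu>3) \<longleftrightarrow> \<mu>3 \<noteq> 0"
| "admissible (L22 \<mu>2 \<mu>3) \<longleftrightarrow> \<mu>2 \<noteq> 0 \<and> \<mu>3 \<noteq> 0"
| "admissible (L25 \<mu>2) \<longleftrightarrow> \<mu>2 \<noteq> 0"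
| "admissible (L31 \<mu>3) \<longleftrightarrow> \<mu>3 \<noteq> 0"
| "admissible (L34 \<mu>3) \<longleftrightarrow> \<mu>3 \<noteq> 0"
| "admissible _ \<longleftrightarrow> True"

(* Rescaling x by a nonzero t and permuting e1, e2, e3 identifies some members of one and the
   same family (for instance L20(\<mu>2,\<mu>3) and L20(\<mu>3,\<mu>2)), so pairwise
   non-isomorphism can only hold modulo these changes of parameters; the multisets are those of
   eigenvalues of [-,x]. The lemma same_params_isomorphic shows that all these identifications
   do occur. Different families, and different parameters in L25, L29, L31, L32, L34, L35 and
   L38, are never related. *)
inductive same_params :: "alg \<Rightarrow> alg \<Rightarrow> bool" where
  refl: "same_params p p"
| L20: "{#1, \<mu>2', \<mu>3'#} = {#t, t * \<mu>2, t * \<mu>3#} \<Longrightarrow>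
    same_params (L20 \<mu>2 \<mu>3) (L20 \<mu>2' \<mu>3')"
| L21: "{#1, \<mu>2'#} = {#t, t * \<mu>2#} \<Longrightarrow> \<mu>3' = t * \<mu>3 \<Longrightarrow>
    same_params (L21 \<mu>2 \<mu>3) (L21 \<mu>2' \<mu>3')"
| L22: "same_params (L22 \<mu>2 \<mu>3) (L22 \<mu>3 \<mu>2)"
| L23: "{#1, \<mu>2', \<mu>3'#} = {#t, t * \<mu>2, t * \<mu>3#} \<Longrightarrow>
    same_params (L23 \<mu>2 \<mu>3) (L23 \<mu>2' \<mu>3')"
| L24: "{#1, \<mu>2'#} = {#t, t * \<mu>2#} \<Longrightarrow> same_params (L24 \<mu>2) (L24 \<mu>2')"
| L26: "{#1, \<mu>2'#} = {#t, t * \<mu>2#} \<Longrightarrow> same_params (L26 \<mu>2) (L26 \<mu>2')"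

lemma table_bracket_nth:
  "table_bracket T u v $ k =
     u $ X * v $ X * T (X, X) $ k + u $ X * v $ E1 * T (X, E1) $ k +
     u $ X * v $ E2 * T (X, E2) $ k + u $ X * v $ E3 * T (X, E3) $ k +
     u $ E1 * v $ X * T (E1, X) $ k + u $ E1 * v $ E1 * T (E1, E1) $ k +
     u $ E1 * v $ E2 * T (E1, E2) $ k + u $ E1 * v $ E3 * T (E1, E3) $ k +
     u $ E2 * v $ X * T (E2, X) $ k + u $ E2 * v $ E1 * T (E2, E1) $ k +
     u $ E2 * v $ E2 * T (E2, E2) $ k + u $ E2 * v $ E3 * T (E2, E3) $ k +
     u $ E3 * v $ X * T (E3, X) $ k + u $ E3 * v $ E1 * T (E3, E1) $ k +
     u $ E3 * v $ E2 * T (E3, E2) $ k + u $ E3 * v $ E3 * T (E3, E3) $ k"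
  by (simp add: table_bracket_def UNIV_gen)

lemma e_nth: "e i $ k = (if k = i then 1 else 0)"
  by (simp add: e_def axis_def)

lemma leibniz_table: "leibniz_algebra (*s) (table_bracket (mult_table p))"
proof (intro leibniz_algebra.intro leibniz_algebra_axioms.intro)
  show "vector_space ((*s) :: complex \<Rightarrow> complex ^ gen \<Rightarrow> _)"
    by (rule vec.vector_space_axioms)
next
  fix y
  show "Vector_Spaces.linear (*s) (*s) (\<lambda>x. table_bracket (mult_table p) x y)"
    by (rule Vector_Spaces.linear_iff[THEN iffD2])
       (simp add: vec.vector_space_axioms table_bracket_nth vec_eq_iff algebra_simps)
next
  fix x
  show "Vector_Spaces.linear (*s) (*s) (\<lambda>y. table_bracket (mult_table p) x y)"
    by (rule Vector_Spaces.linear_iff[THEN iffD2])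
       (simp add: vec.vector_space_axioms table_bracket_nth vec_eq_iff algebra_simps)
next
  fix x y z
  let ?b = "table_bracket (mult_table p)"
  have "?b x (?b y z) $ k = (?b (?b x y) z - ?b (?b x z) y) $ k" for k
    by (cases p; simp add: table_bracket_nth e_nth; cases k; simp add: algebra_simps)
  then show "?b x (?b y z) = ?b (?b x y) z - ?b (?b x z) y"
    by (simp add: vec_eq_iff)
qed

lemma isomorphic_tablesI:
  assumes \<tau>: "bij \<tau>" and c: "\<And>k. c k \<noteq> 0"
    and hom: "\<And>u v k. c k * table_bracket S u v $ \<tau> k =
        table_bracket T (\<chi> k. c k * u $ \<tau> k) (\<chi> k. c k * v $ \<tau> k) $ k"
  shows "isomorphic_algebras (*s) (table_bracket S) (*s) (table_bracket T)"
  unfolding isomorphic_algebras_def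
proof (intro exI conjI allI)
  let ?f = "\<lambda>u :: complex ^ gen. \<chi> k. c k * u $ \<tau> k"
  show "Vector_Spaces.linear (*s) (*s) ?f"
    by (rule Vector_Spaces.linear_iff[THEN iffD2])
       (simp add: vec.vector_space_axioms vec_eq_iff algebra_simps)
  have "?f (\<chi> j. u $ (inv \<tau> j) / c (inv \<tau> j)) = u" for u
    using c by (simp add: vec_eq_iff inv_f_f[OF bij_is_inj[OF \<tau>]])
  moreover have "(\<chi> j. ?f u $ (inv \<tau> j) / c (inv \<tau> j)) = u" for u
    using c by (simp add: vec_eq_iff surj_f_inv_f[OF bij_is_surj[OF \<tau>]])
  ultimately show "bij ?f"
    by (intro o_bij[of "\<lambda>u. \<chi> j. u $ (inv \<tau> j) / c (inv \<tau> j)"]) (auto simp: fun_eq_iff)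
  show "?f (table_bracket S u v) = table_bracket T (?f u) (?f v)" for u v
    using hom by (simp add: vec_eq_iff)
qed

lemma mset3_cases:
  assumes "{#a', b', c'#} = {#a, b, c#}"
  obtains i j k where "{i, j, k} = {E1, E2, E3}"
    "a' = case_gen 0 a b c i" "b' = case_gen 0 a b c j" "c' = case_gen 0 a b c k"
proof -
  have "a' = a \<and> (b' = b \<and> c' = c \<or> b' = c \<and> c' = b) \<or>
        a' = b \<and> (b' = a \<and> c' = c \<or> b' = c \<and> c' = a) \<or>
        a' = c \<and> (b' = a \<and> c' = b \<or> b' = b \<and> c' = a)"
    using assms by (auto simp: add_eq_conv_ex)
  then show ?thesis
    using that[of E1 E2 E3] that[of E1 E3 E2] that[of E2 E1 E3]
      that[of E2 E3 E1] that[of E3 E1 E2] that[of E3 E2 E1]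
    by auto
qed

lemma same_params_isomorphic:
  assumes "same_params p q"
  shows "isomorphic_algebras (*s) (table_bracket (mult_table p))
                             (*s) (table_bracket (mult_table q))"
proof -
  have bij: "bij (case_gen X i j k)" if "{i, j, k} = {E1, E2, E3}" for i j k
  proof -
    have "surj (case_gen X i j k)"
      using that by (auto simp: UNIV_gen)
    then show ?thesis
      by (simp add: bij_def finite_UNIV_surj_inj)
  qed
  note tb = table_bracket_nth e_nth
  have "isomorphic_algebras (*s) (table_bracket (mult_table (A \<mu>2 \<mu>3)))
                            (*s) (table_bracket (mult_table (A \<mu>2' \<mu>3')))"
    if A: "A = L20 \<or> A = L23" and m: "{#1, \<mu>2', \<mu>3'#} = {#t, t * \<mu>2, t * \<mu>3#}"
    for A \<mu>2 \<mu>3 \<mu>2' \<mu>3' t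
  proof -
    obtain i j k where ijk: "{i, j, k} = {E1, E2, E3}"
      and m': "1 = case_gen 0 t (t * \<mu>2) (t * \<mu>3) i" "\<mu>2' = case_gen 0 t (t * \<mu>2) (t * \<mu>3) j"
        "\<mu>3' = case_gen 0 t (t * \<mu>2) (t * \<mu>3) k"
      using m by (rule mset3_cases)
    have t: "t \<noteq> 0"
      using m'(1) by (auto split: gen.splits)
    have ijk': "i \<noteq> X" "j \<noteq> X" "k \<noteq> X"
      using ijk by auto
    define \<tau> where "\<tau> = case_gen X i j k"
    have e1: "case_gen 0 1 \<mu>2' \<mu>3' l = t * case_gen 0 1 \<mu>2 \<mu>3 (\<tau> l)" for l
      using ijk' m' by (cases l; cases i; cases j; cases k) (simp_all add: \<tau>_def)
    have A20: "table_bracket (mult_table (L20 a b)) u v $ l =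
        case_gen 0 1 a b l * (u $ l * v $ X - u $ X * v $ l)" for a b u v l
      by (cases l) (simp_all add: tb algebra_simps)
    have A23: "table_bracket (mult_table (L23 a b)) u v $ l =
        case_gen 0 1 a b l * (u $ l * v $ X)" for a b u v l
      by (cases l) (simp_all add: tb algebra_simps)
    define c where "c l = (if l = X then 1 / t else 1)" for l :: gen
    have "\<tau> X = X" "c X = 1 / t"
      by (simp_all add: \<tau>_def c_def)
    have c0: "c l \<noteq> 0" for l
      using t by (simp add: c_def)
    have "bij \<tau>"
      unfolding \<tau>_def using ijk by (rule bij)
    from A this c0 show ?thesis
      using t by (elim disjE; intro isomorphic_tablesI[of \<tau> c])
         (simp_all add: A20 A23 e1 field_simps \<open>\<tau> X = X\<close> \<open>c X = 1 / t\<close> del: mult_table.simps)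
  qed
  note I = this
  show ?thesis
    using assms
  proof cases
    case refl
    then show ?thesis
      by (auto simp: isomorphic_algebras_def intro!: exI[of _ id] vec.linear_id)
  next
    case (L22 \<mu>2 \<mu>3)
    then show ?thesis
      by (auto intro!: isomorphic_tablesI[where \<tau> = "case_gen X E1 E3 E2" and c = "\<lambda>_. 1"] bij
          simp: tb split: gen.split)
  next
    case (L21 \<mu>2' t \<mu>2 \<mu>3' \<mu>3)
    then have "t = 1 \<and> \<mu>2' = \<mu>2 \<or> t * \<mu>2 = 1 \<and> \<mu>2' = t" "t \<noteq> 0"
      by (auto simp: add_eq_conv_ex)
    then show ?thesis
    proof (elim disjE conjE)
      assume "t = 1" "\<mu>2' = \<mu>2"
      with L21 show ?thesis
        by (auto simp: isomorphic_algebras_def intro!: exI[of _ id] vec.linear_id)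
    next
      assume "t * \<mu>2 = 1" "\<mu>2' = t"
      then have "\<mu>2 = 1 / t"
        using \<open>t \<noteq> 0\<close> by (simp add: field_simps)
      with L21 \<open>t \<noteq> 0\<close> \<open>\<mu>2' = t\<close> show ?thesis
        by (intro isomorphic_tablesI[OF bij[of E2 E1 E3], where c = "case_gen (1 / t) 1 1 1"])
           (auto simp: tb field_simps split: gen.split)
    qed
  next
    case (L24 \<mu>2' t \<mu>2)
    then have "t = 1 \<and> \<mu>2' = \<mu>2 \<or> t * \<mu>2 = 1 \<and> \<mu>2' = t" "t \<noteq> 0"
      by (auto simp: add_eq_conv_ex)
    then show ?thesis
    proof (elim disjE conjE)
      assume "t = 1" "\<mu>2' = \<mu>2"
      with L24 show ?thesis
        by (auto simp: isomorphic_algebras_def intro!: exI[of _ id] vec.linear_id)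
    next
      assume "t * \<mu>2 = 1" "\<mu>2' = t"
      then have "\<mu>2 = 1 / t"
        using \<open>t \<noteq> 0\<close> by (simp add: field_simps)
      with L24 \<open>t \<noteq> 0\<close> \<open>\<mu>2' = t\<close> show ?thesis
        by (intro isomorphic_tablesI[OF bij[of E2 E1 E3], where c = "case_gen (1 / t) 1 1 (1 / t^2)"])
           (auto simp: tb field_simps power2_eq_square split: gen.split)
    qed
  next
    case (L26 \<mu>2' t \<mu>2)
    then have "t = 1 \<and> \<mu>2' = \<mu>2 \<or> t * \<mu>2 = 1 \<and> \<mu>2' = t" "t \<noteq> 0"
      by (auto simp: add_eq_conv_ex)
    then show ?thesis
    proof (elim disjE conjE)
      assume "t = 1" "\<mu>2' = \<mu>2"
      with L26 show ?thesis
        by (auto simp: isomorphic_algebras_def intro!: exI[of _ id] vec.linear_id)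
    next
      assume "t * \<mu>2 = 1" "\<mu>2' = t"
      then have "\<mu>2 = 1 / t"
        using \<open>t \<noteq> 0\<close> by (simp add: field_simps)
      with L26 \<open>t \<noteq> 0\<close> \<open>\<mu>2' = t\<close> show ?thesis
        by (intro isomorphic_tablesI[OF bij[of E2 E1 E3], where c = "case_gen (1 / t) 1 1 (1 / t^2)"])
           (auto simp: tb field_simps power2_eq_square split: gen.split)
    qed
  qed (simp_all only: I simp_thms)
qed

end

theory Submission
  imports Defs "HOL-Computational_Algebra.Fundamental_Theorem_Algebra"
begin

text \<open>
  Let \<open>L\<close> be such an algebra, \<open>N\<close> its nilradical and \<open>x\<close> a vector outside \<open>N\<close>. As \<open>N\<close> is abelian of
  codimension one, the whole product is encoded by three pieces of data: the operators
  \<open>D = [_, x]\<close> and \<open>A = [x, _]\<close> on \<open>N\<close>, and the vector \<open>[x, x]\<close>, which lies in \<open>N\<close> because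
  \<open>[x, [x, x]] = 0\<close>. With \<open>B = A + D\<close>, the Leibniz identity says that \<open>A D = D A\<close>, \<open>A B = 0\<close> and
  \<open>A [x, x] = 0\<close>. Maximality of \<open>N\<close> says that \<open>D\<close> is not nilpotent, since otherwise \<open>L\<close> itself
  would be a nilpotent ideal. Another choice \<open>c x + u\<close> of the outer vector, \<open>u \<in> N\<close>, multiplies \<open>D\<close>
  and \<open>A\<close> by \<open>c\<close> and turns \<open>[x, x]\<close> into \<open>c\<^sup>2 [x, x] + c B u\<close>.

  That every algebra occurs in the list rests on a decomposition of \<open>N\<close>. Fitting's lemma splits
  \<open>N = N0 \<oplus> N1\<close> with \<open>D\<close> nilpotent on \<open>N0\<close> and invertible on \<open>N1\<close>. On \<open>N1\<close> the operators \<open>- D\<^sup>-\<^sup>1 A\<close> and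
  \<open>D\<^sup>-\<^sup>1 B\<close> are complementary projections because of \<open>A B = 0\<close>, and thus \<open>N1 = A N1 \<oplus> B N1\<close>, where
  \<open>A = - D\<close> on the first summand and \<open>A = 0\<close> on the second. The vector
  \<open>[x, x]\<close> can be moved into \<open>N0\<close> by a change of \<open>x\<close> (\<open>weight_decomposition\<close>). On \<open>N1\<close> it
  remains to put \<open>D\<close> into Jordan form on each summand; on \<open>N0\<close>, of dimension at most two, two
  commuting nilpotent operators are easy to normalise. Scaling \<open>x\<close> makes one eigenvalue equal
  to 1. The dimensions of the three summands, the Jordan types and the fate of \<open>[x, x]\<close> then
  name the table: \<open>classified_invertible\<close>, \<open>classified_nil_dim1\<close>, \<open>classified_nil_dim2\<close>.

  To tell the tables apart, note that in each of them the span of \<open>e1, e2, e3\<close> consists of the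
  vectors \<open>u\<close> for which right multiplication by \<open>u\<close> squares to zero. An isomorphism preserves it. It therefore conjugates
  the pairs \<open>(D, A)\<close> up to one common factor \<open>a \<noteq> 0\<close> and matches the squares of \<open>x\<close> modulo the
  image of \<open>B\<close> (\<open>isomorphism_intertwines\<close>). The eigenvalues of \<open>A\<close> and of \<open>B\<close>, up to that common
  factor and recovered from the traces of powers, together with a few invariants that detect Jordan
  blocks and the class of \<open>[x, x]\<close>, determine the table and its parameters up to the listed changes
  of parameters (\<open>isomorphic_tables_same_params\<close>).
\<close>

section \<open>Ordered bases, direct sums and the Fitting decomposition\<close>

text \<open>
  A locale of its own keeps the notions below attached to a single space; otherwise they would also be
  instantiated for every Euclidean space.
\<close>

locale fd_space = finite_dimensional_vector_space
begin

definition ordered_basis :: "'b set \<Rightarrow> 'b list \<Rightarrow> bool" where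
  "ordered_basis S es \<longleftrightarrow> distinct es \<and> independent (set es) \<and> span (set es) = S"

definition direct_sum :: "'b set \<Rightarrow> 'b set \<Rightarrow> 'b set \<Rightarrow> bool" where
  "direct_sum S A B \<longleftrightarrow>
     subspace A \<and> subspace B \<and> A \<inter> B = {0} \<and> S = {a + b |a b. a \<in> A \<and> b \<in> B}"

lemma ordered_basis_subspace: "ordered_basis S es \<Longrightarrow> subspace S"
  by (auto simp: ordered_basis_def)

lemma ordered_basis_dim: "ordered_basis S es \<Longrightarrow> dim S = length es"
  unfolding ordered_basis_def
  by (metis dim_span_eq_card_independent distinct_card)

lemma ordered_basis_exists:
  assumes "subspace S"
  shows "\<exists>es. ordered_basis S es"
proof -
  obtain B where B: "B \<subseteq> S" "independent B" "S \<subseteq> span B"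
    using basis_exists[of S] by metis
  obtain es where "set es = B" "distinct es"
    using finite_distinct_list[OF finiteI_independent[OF B(2)]] by blast
  with B assms span_minimal[OF B(1)] show ?thesis
    by (intro exI[of _ es]) (auto simp: ordered_basis_def)
qed

lemma ordered_basis_append:
  assumes "direct_sum S A B" "ordered_basis A es" "ordered_basis B fs"
  shows "ordered_basis S (es @ fs)"
proof -
  have A: "distinct es" "independent (set es)" "span (set es) = A"
    and B: "distinct fs" "independent (set fs)" "span (set fs) = B"
    and AB: "A \<inter> B = {0}" and S: "S = {a + b |a b. a \<in> A \<and> b \<in> B}"
    using assms by (auto simp: ordered_basis_def direct_sum_def)
  have "0 \<notin> set es" using A(2) dependent_zero by blast
  then have disj: "set es \<inter> set fs = {}"
    using A(3) B(3) AB by (metis IntI disjoint_iff singletonD span_base)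
  have "c v = 0" if c: "(\<Sum>v\<in>set es \<union> set fs. scale (c v) v) = 0" and v: "v \<in> set es \<union> set fs" for c v
  proof -
    let ?a = "\<Sum>v\<in>set es. scale (c v) v" and ?b = "\<Sum>v\<in>set fs. scale (c v) v"
    have "?a \<in> span (set es)" "?b \<in> span (set fs)"
      by (intro span_sum span_scale span_base; assumption)+
    then have "?a \<in> A" "?b \<in> B"
      unfolding A(3) B(3) .
    moreover have "?a + ?b = 0"
      using c disj by (simp add: sum.union_disjoint)
    then have "?a = - ?b" by (simp add: eq_neg_iff_add_eq_0)
    moreover have "- ?b \<in> B"
      using \<open>?b \<in> B\<close> B(3) span_neg by blast
    ultimately have "?a \<in> A \<inter> B" by auto
    then have "?a = 0" "?b = 0"
      using AB \<open>?a = - ?b\<close> by auto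
    then show "c v = 0"
      using v A(2) B(2) by (auto simp: independent_explicit)
  qed
  then have "independent (set es \<union> set fs)"
    by (simp add: independent_explicit)
  then show ?thesis
    using A B disj S by (simp add: ordered_basis_def span_Un)
qed

lemma direct_sum_dim:
  assumes "direct_sum S A B"
  shows "dim S = dim A + dim B"
proof -
  have "subspace A" "subspace B"
    using assms by (auto simp: direct_sum_def)
  then obtain es fs where "ordered_basis A es" "ordered_basis B fs"
    using ordered_basis_exists by metis
  then show ?thesis
    using ordered_basis_append[OF assms] by (metis ordered_basis_dim length_append)
qed

lemma ordered_basis2I:
  assumes S: "subspace S" "dim S = 2" "e1 \<in> S" "e2 \<in> S"
    and ind: "\<And>a b. scale a e1 + scale b e2 = 0 \<Longrightarrow> a = 0 \<and> b = 0"
  shows "ordered_basis S [e1, e2]"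
proof -
  have e2: "e2 \<noteq> 0" using ind[of 0 1] by auto
  have e1: "e1 \<notin> span {e2}"
  proof
    assume "e1 \<in> span {e2}"
    then obtain k where "e1 = scale k e2"
      by (auto simp: span_singleton)
    with ind[of 1 "- k"] show False by simp
  qed
  have i: "independent {e1, e2}" using e1 e2 by (simp add: independent_insert)
  have ne: "e1 \<noteq> e2" using e1 span_base by auto
  have "S \<subseteq> span {e1, e2}"
    using card_ge_dim_independent[of "{e1, e2}" S] i ne S by auto
  with S have "span {e1, e2} = S"
    by (intro subset_antisym span_minimal) auto
  with i ne show ?thesis by (simp add: ordered_basis_def)
qed

lemma ordered_basis3I:
  assumes S: "subspace S" "dim S = 3" "e1 \<in> S" "e2 \<in> S" "e3 \<in> S"
    and ind: "\<And>a b c. scale a e1 + scale b e2 + scale c e3 = 0 \<Longrightarrow> a = 0 \<and> b = 0 \<and> c = 0"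
  shows "ordered_basis S [e1, e2, e3]"
proof -
  have e3: "e3 \<noteq> 0" using ind[of 0 0 1] by auto
  have e2: "e2 \<notin> span {e3}"
  proof
    assume "e2 \<in> span {e3}"
    then obtain k where "e2 = scale k e3"
      by (auto simp: span_singleton)
    with ind[of 0 1 "- k"] show False by simp
  qed
  have e1: "e1 \<notin> span {e2, e3}"
  proof
    assume "e1 \<in> span {e2, e3}"
    then obtain k l where "e1 - scale k e2 - scale l e3 = 0"
      by (auto simp: span_breakdown_eq)
    with ind[of 1 "-k" "-l"] show False by auto
  qed
  have i: "independent {e1, e2, e3}" using e1 e2 e3 by (simp add: independent_insert)
  have ne: "e1 \<noteq> e2" "e1 \<noteq> e3" "e2 \<noteq> e3" using e1 e2 span_base by auto
  have "S \<subseteq> span {e1, e2, e3}"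
    using card_ge_dim_independent[of "{e1, e2, e3}" S] i ne S by auto
  with S have "span {e1, e2, e3} = S"
    by (intro subset_antisym span_minimal) auto
  with i ne show ?thesis by (simp add: ordered_basis_def)
qed

lemma ordered_basis3_coords:
  assumes "ordered_basis S [e1, e2, e3]" "u \<in> S"
  obtains a b c where "u = scale a e1 + scale b e2 + scale c e3"
proof -
  have "u \<in> span {e1, e2, e3}" using assms by (simp add: ordered_basis_def)
  then obtain a b c where "u - scale a e1 - scale b e2 - scale c e3 = 0"
    by (auto simp: span_breakdown_eq)
  then have "u = scale a e1 + scale b e2 + scale c e3"
    by (simp add: algebra_simps)
  then show ?thesis by (rule that)
qed

lemma ordered_basis3_indep:
  assumes "ordered_basis S [e1, e2, e3]" "scale a e1 + scale b e2 + scale c e3 = 0"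
  shows "a = 0 \<and> b = 0 \<and> c = 0"
proof -
  have i: "independent {e1, e2, e3}" and d: "e1 \<noteq> e2" "e1 \<noteq> e3" "e2 \<noteq> e3"
    using assms(1) by (auto simp: ordered_basis_def)
  let ?c = "\<lambda>v. if v = e1 then a else if v = e2 then b else c"
  have "(\<Sum>v\<in>{e1, e2, e3}. scale (?c v) v) = 0"
    using d assms(2) by (simp add: add.assoc)
  then have "\<forall>v\<in>{e1, e2, e3}. ?c v = 0"
    using conjunct2[OF i[unfolded independent_explicit], THEN spec, of ?c] by blast
  then show ?thesis using d by auto
qed

lemma ordered_basis2_coords:
  assumes "ordered_basis S [e1, e2]" "u \<in> S"
  obtains a b where "u = scale a e1 + scale b e2"
proof -
  have "u \<in> span {e1, e2}" using assms by (simp add: ordered_basis_def)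
  then obtain a b where "u - scale a e1 - scale b e2 = 0"
    by (auto simp: span_breakdown_eq)
  then have "u = scale a e1 + scale b e2"
    by (simp add: algebra_simps)
  then show ?thesis by (rule that)
qed

lemma funpow_linear:
  assumes "Vector_Spaces.linear scale scale T"
  shows "Vector_Spaces.linear scale scale (T ^^ k)"
proof (induction k)
  case 0
  show ?case using linear_id by (simp add: id_def)
next
  case (Suc k)
  then show ?case
    using Vector_Spaces.linear_compose[OF Suc assms] by (simp add: o_def)
qed

lemma funpow_invariant:
  assumes "T ` S \<subseteq> S"
  shows "(T ^^ k) ` S \<subseteq> S"
  using assms by (induction k) auto

text \<open>
  The image of a basis of \<open>I\<close> spans \<open>I\<close> and has no more elements than the basis, so it is again a
  basis.
\<close>

lemma linear_surj_on_imp_inj_on: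
  assumes T: "Vector_Spaces.linear scale scale T" and I: "subspace I" "T ` I = I"
    and u: "u \<in> I" "T u = 0"
  shows "u = 0"
proof -
  interpret T: Vector_Spaces.linear scale scale T by (rule T)
  obtain B where B: "B \<subseteq> I" "independent B" "I \<subseteq> span B" "card B = dim I"
    using basis_exists[of I] by metis
  have span: "span B = I"
    using B I span_minimal by blast
  have fB: "finite B" by (rule finiteI_independent[OF B(2)])
  have sT: "span (T ` B) = I"
    using T.span_image[of B] span I by simp
  have c: "card (T ` B) = card B"
    using card_image_le[OF fB, of T] dim_le_card[of I "T ` B"] sT fB B(4) by simp
  then have inj: "inj_on T B" using fB by (simp add: eq_card_imp_inj_on)
  have "independent (T ` B)"
    using card_eq_dim[of "T ` B" I] sT c B(4) fB span_superset[of "T ` B"] by auto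
  then have "inj_on T (span B)"
    using T.inj_on_span_independent_image[OF _ inj] by blast
  then show ?thesis
    using u span T.zero span_zero by (metis inj_onD)
qed

text \<open>
  The images \<open>T\<^sup>k S\<close> decrease, so one of minimal dimension is mapped onto itself by \<open>T\<close>, hence
  bijectively. For \<open>u \<in> S\<close> there is then \<open>w\<close> in that image with \<open>T\<^sup>k u = T\<^sup>k w\<close>, and
  \<open>u = (u - w) + w\<close> is the required splitting.
\<close>

lemma fitting_decomposition:
  assumes T: "Vector_Spaces.linear scale scale T" and S: "subspace S" and TS: "T ` S \<subseteq> S"
  obtains k where "direct_sum S {u \<in> S. (T ^^ k) u = 0} ((T ^^ k) ` S)"
    and "\<forall>u\<in>(T ^^ k) ` S. T u = 0 \<longrightarrow> u = 0"
    and "T ` (T ^^ k) ` S = (T ^^ k) ` S"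
proof -
  interpret T: Vector_Spaces.linear scale scale T by (rule T)
  interpret Tk: Vector_Spaces.linear scale scale "T ^^ k" for k
    by (rule funpow_linear[OF T])
  define I where "I k = (T ^^ k) ` S" for k
  have sI: "subspace (I k)" for k
    unfolding I_def by (rule Tk.subspace_image[OF S])
  obtain k where k: "\<And>j. dim (I k) \<le> dim (I j)"
    using ex_has_least_nat[of "\<lambda>_. True" 0 "\<lambda>k. dim (I k)"] by auto
  have ISuc: "I (Suc j) = T ` I j" for j
    by (auto simp: I_def)
  have sub: "I (Suc k) \<subseteq> I k"
    unfolding I_def funpow_Suc_right using TS by auto
  have TI: "T ` I k = I k"
    using subspace_dim_equal[OF sI sI sub k] ISuc by simp
  have TjI: "(T ^^ j) ` I k = I k" for j
  proof (induction j)
    case (Suc j)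
    have "(T ^^ Suc j) ` I k = T ` ((T ^^ j) ` I k)" by (simp add: image_comp)
    then show ?case using Suc TI by simp
  qed simp
  have inj: "u = 0" if "u \<in> I k" "T u = 0" for u
    by (rule linear_surj_on_imp_inj_on[OF T sI TI that])
  have injj: "u = 0" if "u \<in> I k" "(T ^^ j) u = 0" for u j
    by (rule linear_surj_on_imp_inj_on[OF funpow_linear[OF T] sI TjI that])
  have "direct_sum S {u \<in> S. (T ^^ k) u = 0} (I k)"
    unfolding direct_sum_def
  proof (intro conjI)
    show K: "subspace {u \<in> S. (T ^^ k) u = 0}"
      using S by (auto simp: subspace_def Tk.add Tk.scale Tk.zero)
    show "subspace (I k)" by (rule sI)
    show "{u \<in> S. (T ^^ k) u = 0} \<inter> I k = {0}"
      using injj subspace_0[OF sI] subspace_0[OF S] Tk.zero by auto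
    have IS: "I k \<subseteq> S" unfolding I_def by (rule funpow_invariant[OF TS])
    have "u \<in> {a + b |a b. a \<in> {u \<in> S. (T ^^ k) u = 0} \<and> b \<in> I k}" if u: "u \<in> S" for u
    proof -
      have "(T ^^ k) u \<in> (T ^^ k) ` I k"
        using TjI u by (auto simp: I_def)
      then obtain w where w: "w \<in> I k" "(T ^^ k) u = (T ^^ k) w" by auto
      then have "u - w \<in> {u \<in> S. (T ^^ k) u = 0}"
        using u IS S by (auto simp: Tk.diff subspace_diff)
      then show ?thesis
        using w(1) by (intro CollectI exI[of _ "u - w"] exI[of _ w]) auto
    qed
    then show "S = {a + b |a b. a \<in> {u \<in> S. (T ^^ k) u = 0} \<and> b \<in> I k}"
      using IS S by (auto intro: subspace_add)
  qed
  then show ?thesis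
    using that[of k] inj TI unfolding I_def by blast
qed

lemma ordered_basis_Nil: "dim S = 0 \<Longrightarrow> subspace S \<Longrightarrow> ordered_basis S []"
  using independent_empty by (auto simp: ordered_basis_def dim_eq_0 subspace_0)

lemma ordered_basis_mem: "ordered_basis S es \<Longrightarrow> set es \<subseteq> S"
  using span_superset by (auto simp: ordered_basis_def)

lemma ordered_basis3_rotate: "ordered_basis S [a, b, c] \<Longrightarrow> ordered_basis S [b, c, a]"
  by (auto simp: ordered_basis_def insert_commute)

lemma ordered_basis3_swap: "ordered_basis S [a, b, c] \<Longrightarrow> ordered_basis S [b, a, c]"
  by (auto simp: ordered_basis_def insert_commute)

lemma ordered_basis3_scale:
  assumes "ordered_basis S [e1, e2, e3]" "a \<noteq> 0" "b \<noteq> 0" "c \<noteq> 0"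
  shows "ordered_basis S [scale a e1, scale b e2, scale c e3]"
proof (rule ordered_basis3I)
  show S: "subspace S" "dim S = 3"
    using assms(1) ordered_basis_subspace ordered_basis_dim by fastforce+
  have "{e1, e2, e3} \<subseteq> S"
    using assms(1) span_superset[of "{e1, e2, e3}"] by (simp add: ordered_basis_def)
  then show "scale a e1 \<in> S" "scale b e2 \<in> S" "scale c e3 \<in> S"
    using S(1) by (auto intro: subspace_scale)
  show "x = 0 \<and> y = 0 \<and> z = 0" if "scale x (scale a e1) + scale y (scale b e2) + scale z (scale c e3) = 0" for x y z
    using ordered_basis3_indep[OF assms(1), of "x * a" "y * b" "z * c"] that assms by simp
qed

end

section \<open>Eigenvectors over the complex numbers\<close>

locale complex_fd_space = fd_space scale Basis
  for scale :: "complex \<Rightarrow> 'b::ab_group_add \<Rightarrow> 'b" and Basis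
begin

text \<open>
  The vector \<open>p(T) w\<close>, computed by Horner's scheme.
\<close>

definition poly_op :: "complex poly \<Rightarrow> ('b \<Rightarrow> 'b) \<Rightarrow> 'b \<Rightarrow> 'b" where
  "poly_op p T w = fold_coeffs (\<lambda>a u. scale a w + T u) p 0"

context
  fixes T :: "'b \<Rightarrow> 'b"
  assumes T: "Vector_Spaces.linear scale scale T"
begin

interpretation T: Vector_Spaces.linear scale scale T by (rule T)

lemma poly_op_pCons: "poly_op (pCons a p) T w = scale a w + T (poly_op p T w)"
  by (cases "p = 0 \<and> a = 0") (auto simp: poly_op_def T.zero)

lemma poly_op_0: "poly_op 0 T w = 0"
  by (simp add: poly_op_def)

lemma poly_op_add: "poly_op (p + q) T w = poly_op p T w + poly_op q T w"
proof (induction p q rule: poly_induct2)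
  case 0
  then show ?case by (simp add: poly_op_0)
next
  case (pCons a p b q)
  then show ?case
    by (simp add: poly_op_pCons T.add algebra_simps)
qed

lemma poly_op_smult: "poly_op (smult c p) T w = scale c (poly_op p T w)"
  by (induction p) (auto simp: poly_op_0 poly_op_pCons T.scale algebra_simps)

lemma poly_op_linear_factor:
  "poly_op ([:- r, 1:] * q) T w = T (poly_op q T w) - scale r (poly_op q T w)"
proof -
  have "[:- r, 1:] * q = smult (- r) q + pCons 0 q" by simp
  then show ?thesis
    by (simp only: poly_op_add poly_op_smult poly_op_pCons) simp
qed

lemma poly_op_monom: "poly_op (monom c i) T w = scale c ((T ^^ i) w)"
  by (induction i) (auto simp: monom_0 monom_Suc poly_op_pCons poly_op_0 T.zero T.scale)

lemma poly_op_sum: "poly_op (\<Sum>i\<in>I. p i) T w = (\<Sum>i\<in>I. poly_op (p i) T w)"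
  by (induction I rule: infinite_finite_induct) (auto simp: poly_op_0 poly_op_add)

lemma poly_op_mem:
  assumes "subspace S" "T ` S \<subseteq> S" "w \<in> S"
  shows "poly_op p T w \<in> S"
  using assms by (induction p) (auto simp: poly_op_0 poly_op_pCons subspace_0
      intro!: subspace_add subspace_scale)

text \<open>
  The vectors \<open>w, T w, T\<^sup>2 w, \<dots>\<close> cannot all be distinct and independent; a repetition or a linear
  relation among them is a polynomial.
\<close>

lemma annihilating_poly_exists:
  obtains p where "p \<noteq> 0" "poly_op p T w = 0"
proof (cases "inj_on (\<lambda>i. (T ^^ i) w) {..dimension}")
  case False
  then obtain i j where ij: "i \<noteq> j" "(T ^^ i) w = (T ^^ j) w"
    by (auto simp: inj_on_def)
  have "poly_op (monom 1 i + monom (-1) j) T w = 0"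
    using ij by (simp add: poly_op_add poly_op_monom)
  moreover have "coeff (monom 1 i + monom (-1) j :: complex poly) i \<noteq> 0"
    using ij by simp
  then have "monom 1 i + monom (-1) j \<noteq> (0 :: complex poly)"
    by (metis coeff_0)
  ultimately show ?thesis by (rule that[rotated])
next
  case True
  let ?f = "\<lambda>i. (T ^^ i) w"
  have "card (?f ` {..dimension}) = dimension + 1"
    using True by (simp add: card_image)
  then have "\<not> independent (?f ` {..dimension})"
    using independent_card_le_dim[OF subset_UNIV, of "?f ` {..dimension}"]
    by (auto simp: dimension_def)
  then obtain u v where u: "(\<Sum>x\<in>?f ` {..dimension}. scale (u x) x) = 0"
    and v: "v \<in> ?f ` {..dimension}" "u v \<noteq> 0"
    by (auto simp: independent_explicit)
  obtain i where i: "i \<le> dimension" "v = ?f i" using v(1) by auto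
  let ?p = "\<Sum>i\<le>dimension. monom (u (?f i)) i"
  have "poly_op ?p T w = (\<Sum>i\<le>dimension. scale (u (?f i)) (?f i))"
    by (simp add: poly_op_sum poly_op_monom)
  also have "\<dots> = 0"
    using u by (subst (asm) sum.reindex[OF True]) (simp add: o_def)
  finally have "poly_op ?p T w = 0" .
  moreover have "coeff ?p i = u (?f i)"
    using i by (simp add: coeff_sum sum.delta)
  then have "?p \<noteq> 0" using i v(2) by (metis coeff_0)
  ultimately show ?thesis by (rule that[rotated])
qed

text \<open>
  Take a non-zero polynomial with \<open>p(T) w = 0\<close> and split off one linear factor \<open>X - r\<close>, leaving \<open>q\<close>.
  Either \<open>q(T) w\<close> is an eigenvector for \<open>r\<close>, or it vanishes and \<open>q\<close> is an annihilating polynomial of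
  smaller degree.
\<close>

lemma eigenvector_exists:
  assumes S: "subspace S" "T ` S \<subseteq> S" "dim S \<noteq> 0"
  obtains l w where "w \<in> S" "w \<noteq> 0" "T w = scale l w"
proof -
  obtain w where w: "w \<in> S" "w \<noteq> 0"
    using S(3) by (auto simp: dim_eq_0)
  obtain p where p: "p \<noteq> 0" "poly_op p T w = 0"
    by (rule annihilating_poly_exists)
  have "\<exists>u l. u \<in> S \<and> u \<noteq> 0 \<and> T u = scale l u" if "p \<noteq> 0" "poly_op p T w = 0" for p
    using that
  proof (induction "degree p" arbitrary: p rule: less_induct)
    case less
    have "degree p \<noteq> 0"
    proof
      assume "degree p = 0"
      then obtain c where "p = [:c:]" by (rule degree_eq_zeroE)
      with less.prems w show False by (simp add: poly_op_pCons poly_op_0 T.zero)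
    qed
    then obtain r where "poly p r = 0"
      using fundamental_theorem_of_algebra[of p] constant_degree[of p] by auto
    then obtain q where q: "p = [:- r, 1:] * q"
      by (auto simp: poly_eq_0_iff_dvd dvd_def)
    with less.prems have q0: "q \<noteq> 0" by auto
    have "degree p = degree q + 1"
      unfolding q using q0 by (subst degree_mult_eq) auto
    show ?case
    proof (cases "poly_op q T w = 0")
      case True
      with less.hyps[of q] q0 \<open>degree p = degree q + 1\<close> show ?thesis by simp
    next
      case False
      moreover have "T (poly_op q T w) = scale r (poly_op q T w)"
        using less.prems(2) unfolding q poly_op_linear_factor by simp
      moreover have "poly_op q T w \<in> S" using S w by (intro poly_op_mem)
      ultimately show ?thesis by blast
    qed
  qed
  with p that show ?thesis by blast
qed

end

end

section \<open>Jordan bases in dimension at most three\<close>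

context fd_space
begin

context
  fixes M :: "'b \<Rightarrow> 'b" and S :: "'b set"
  assumes M: "Vector_Spaces.linear scale scale M" and S: "subspace S" and MS: "M ` S \<subseteq> S"
    and nil: "\<exists>k. \<forall>u\<in>S. (M ^^ k) u = 0"
begin

interpretation M: Vector_Spaces.linear scale scale M by (rule M)

lemma nilpotent_no_eigenvalue:
  assumes w: "w \<in> S" "M w = scale c w" "c \<noteq> 0"
  shows "w = 0"
proof -
  have "(M ^^ k) w = scale (c ^ k) w" for k
    by (induction k) (auto simp: M.scale w mult.commute)
  with nil w show ?thesis by fastforce
qed

lemma nilpotent_last_power:
  assumes "w \<in> S" "w \<noteq> 0"
  obtains j where "(M ^^ j) w \<noteq> 0" "M ((M ^^ j) w) = 0"
proof -
  obtain k where "(M ^^ k) w = 0" using nil assms by blast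
  then obtain k where k: "(M ^^ k) w = 0" "\<And>j. j < k \<Longrightarrow> (M ^^ j) w \<noteq> 0"
    using exists_least_iff[of "\<lambda>k. (M ^^ k) w = 0"] by blast
  then obtain j where "k = Suc j" using assms by (cases k) auto
  with k show ?thesis by (intro that[of j]) auto
qed

lemma nilpotent_dim1:
  assumes "dim S = 1" "w \<in> S"
  shows "M w = 0"
proof -
  obtain es where es: "ordered_basis S es" using ordered_basis_exists[OF S] by blast
  moreover have "length es = Suc 0" using ordered_basis_dim[OF es] assms by simp
  ultimately obtain e where e: "ordered_basis S [e]"
    by (auto simp: length_Suc_conv)
  then have Se: "S = range (\<lambda>k. scale k e)" by (simp add: ordered_basis_def span_singleton)
  then have "e \<in> S" by (metis rangeI scale_one)
  then obtain c where c: "M e = scale c e" using MS Se by blast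
  have "M e = 0" using nilpotent_no_eigenvalue[OF \<open>e \<in> S\<close> c] c M.zero by auto
  then show ?thesis using assms Se by (auto simp: M.scale)
qed

text \<open>
  If \<open>M\<close> does not vanish, the second alternative holds for a vector \<open>w\<close> such that \<open>M w\<close> is the last non-zero power
  of \<open>M\<close> applied to some vector. Applying \<open>M\<close> to a linear relation between \<open>w\<close> and \<open>M w\<close> shows
  that they are independent.
\<close>

lemma nilpotent_dim2:
  assumes dim: "dim S = 2"
  obtains "\<And>u. u \<in> S \<Longrightarrow> M u = 0"
  | w where "ordered_basis S [w, M w]" "M (M w) = 0"
proof (cases "\<forall>u\<in>S. M u = 0")
  case False
  then obtain w0 where w0: "w0 \<in> S" "M w0 \<noteq> 0" by blast
  define y where "y = M w0"
  have "y \<in> S" "y \<noteq> 0" using w0 MS by (auto simp: y_def)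
  then obtain j where j: "(M ^^ j) y \<noteq> 0" "M ((M ^^ j) y) = 0"
    by (rule nilpotent_last_power)
  define w where "w = (M ^^ j) w0"
  have Mw: "M w = (M ^^ j) y" by (simp add: w_def y_def funpow_swap1)
  have w: "w \<in> S" using funpow_invariant[OF MS, of j] w0 by (auto simp: w_def)
  have "ordered_basis S [w, M w]"
  proof (rule ordered_basis2I[OF S dim w])
    show "M w \<in> S" using w MS by blast
    fix a b assume ab: "scale a w + scale b (M w) = 0"
    then have "M (scale a w + scale b (M w)) = 0" by (simp add: M.zero)
    then have "a = 0" using j by (simp add: M.add M.scale Mw M.zero)
    with ab j show "a = 0 \<and> b = 0" by (simp add: Mw)
  qed
  with j show ?thesis by (intro that(2)[of w]) (simp_all add: Mw)
qed (use that in blast)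

text \<open>
  The three Jordan types of a nilpotent operator, distinguished by the vanishing of \<open>M\<close> and of
  \<open>M\<^sup>2\<close>. If \<open>M \<noteq> 0 = M\<^sup>2\<close>, complete \<open>w, M w\<close> by any third vector \<open>z\<close>. Writing \<open>M z\<close> in this basis
  and applying \<open>M\<close> once more shows that \<open>M z\<close> is a multiple of \<open>M w\<close>, so \<open>z\<close> can be corrected by a
  multiple of \<open>w\<close> to lie in the kernel.
\<close>

lemma nilpotent_dim3:
  assumes dim: "dim S = 3"
  obtains "\<And>u. u \<in> S \<Longrightarrow> M u = 0"
  | w z where "ordered_basis S [w, M w, z]" "M (M w) = 0" "M z = 0"
  | w where "ordered_basis S [w, M w, M (M w)]" "M (M (M w)) = 0"
proof -
  consider "\<forall>u\<in>S. M u = 0" | "\<forall>u\<in>S. M (M u) = 0" "\<exists>u\<in>S. M u \<noteq> 0"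
    | "\<exists>u\<in>S. M (M u) \<noteq> 0" by blast
  then show ?thesis
  proof cases
    case 1
    with that(1) show ?thesis by blast
  next
    case 2
    then obtain w where w: "w \<in> S" "M w \<noteq> 0" "M w \<in> S" "M (M w) = 0" using MS by blast
    have ind: "a = 0 \<and> b = 0" if ab: "scale a w + scale b (M w) = 0" for a b
    proof -
      have "M (scale a w + scale b (M w)) = 0" using ab by (simp add: M.zero)
      then have "a = 0" using w by (simp add: M.add M.scale M.zero)
      with ab w show ?thesis by simp
    qed
    have "\<not> S \<subseteq> span {w, M w}"
    proof
      assume "S \<subseteq> span {w, M w}"
      then have "dim S \<le> card {w, M w}" by (intro dim_le_card) auto
      also have "\<dots> \<le> 2" by (simp add: card_insert_if)
      finally show False using dim by simp
    qed
    then obtain z where z: "z \<in> S" "z \<notin> span {w, M w}" by blast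
    \<comment> \<open>the shift by \<open>d\<close> covers both the vector \<open>z\<close> and its later correction\<close>
    have ind3: "a = 0 \<and> b = 0 \<and> c = 0"
      if abc: "scale a w + scale b (M w) + scale c (z + scale d w) = 0" for a b c d
    proof -
      have "c = 0"
      proof (rule ccontr)
        assume c: "c \<noteq> 0"
        have "scale c z = scale (- a - c * d) w + scale (- b) (M w)"
          using abc by (simp add: algebra_simps eq_neg_iff_add_eq_0)
        then have "scale (1 / c) (scale c z) = scale (1 / c) (scale (- a - c * d) w + scale (- b) (M w))"
          by simp
        then have "z = scale ((- a - c * d) / c) w + scale (- b / c) (M w)"
          using c by (simp add: scale_right_distrib scale_right_diff_distrib)
        moreover have "scale ((- a - c * d) / c) w + scale (- b / c) (M w) \<in> span {w, M w}"
          by (intro span_add span_scale span_base) auto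
        ultimately show False using z by metis
      qed
      with abc ind[of a b] show ?thesis by simp
    qed
    have b0: "ordered_basis S [w, M w, z]"
      using ind3[of _ _ _ 0] w z by (intro ordered_basis3I[OF S dim]) auto
    have Mz: "M z \<in> S" using z MS by blast
    then obtain a b c where abc: "M z = scale a w + scale b (M w) + scale c z"
      by (rule ordered_basis3_coords[OF b0])
    have "M (M z) = 0" using 2 z by blast
    then have "M (scale a w + scale b (M w) + scale c z) = 0"
      by (simp add: abc)
    then have "scale a (M w) + scale c (M z) = 0"
      using w by (simp add: M.add M.scale)
    then have "scale (c * a) w + scale (a + c * b) (M w) + scale (c * c) z = 0"
      unfolding abc by (simp add: algebra_simps)
    from ordered_basis3_indep[OF b0 this] have ac: "a = 0" "c = 0" by auto
    let ?z = "z + scale (- b) w"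
    have "M ?z = 0" using abc ac w by (simp add: M.add M.scale M.zero M.neg M.diff)
    moreover have "ordered_basis S [w, M w, ?z]"
      using ind3[of _ _ _ "- b"] w z S by (intro ordered_basis3I[OF S dim]) (auto intro: subspace_diff subspace_scale)
    ultimately show ?thesis using that(2) w by blast
  next
    case 3
    then obtain w0 where w0: "w0 \<in> S" "M (M w0) \<noteq> 0" by blast
    define y where "y = M (M w0)"
    have "y \<in> S" "y \<noteq> 0" using w0 MS by (auto simp: y_def)
    then obtain j where j: "(M ^^ j) y \<noteq> 0" "M ((M ^^ j) y) = 0"
      by (rule nilpotent_last_power)
    define w where "w = (M ^^ j) w0"
    have Mw: "M (M w) = (M ^^ j) y" by (simp add: w_def y_def funpow_swap1)
    have w: "w \<in> S" "M w \<in> S" "M (M w) \<in> S"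
      using funpow_invariant[OF MS, of j] w0 MS by (simp_all add: w_def image_subset_iff)
    have "ordered_basis S [w, M w, M (M w)]"
    proof (rule ordered_basis3I[OF S dim w])
      fix a b c assume abc: "scale a w + scale b (M w) + scale c (M (M w)) = 0"
      then have "M (M (scale a w + scale b (M w) + scale c (M (M w)))) = 0" by (simp add: M.zero)
      then have a: "a = 0" using j by (simp add: M.add M.scale Mw M.zero)
      from abc have "M (scale a w + scale b (M w) + scale c (M (M w))) = 0" by (simp add: M.zero)
      then have "b = 0" using j a by (simp add: M.add M.scale Mw M.zero)
      with abc j a show "a = 0 \<and> b = 0 \<and> c = 0" by (simp add: Mw)
    qed
    with j show ?thesis by (intro that(3)[of w]) (simp_all add: Mw)
  qed
qed

end

end

context complex_fd_space
begin

context
  fixes T :: "'b \<Rightarrow> 'b"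
  assumes T: "Vector_Spaces.linear scale scale T"
begin

interpretation T: Vector_Spaces.linear scale scale T by (rule T)

text \<open>
  The Fitting decomposition for \<open>M = T / l - 1\<close>, where \<open>l\<close> is an eigenvalue of \<open>T\<close>; its nilpotent
  part \<open>K\<close> contains the eigenvector. Dividing by \<open>l\<close> produces Jordan chains of the form
  \<open>T e1 = l (e1 + e2)\<close>, which lose the factor \<open>l\<close> when \<open>T\<close> is rescaled to \<open>T / l\<close>.
\<close>

lemma primary_component_split:
  assumes S: "subspace S" "T ` S \<subseteq> S" "dim S \<noteq> 0"
    and inj: "\<forall>u\<in>S. T u = 0 \<longrightarrow> u = 0"
  obtains l M K I where "l \<noteq> 0" "direct_sum S K I" "T ` K \<subseteq> K" "T ` I \<subseteq> I" "dim K \<noteq> 0"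
    "Vector_Spaces.linear scale scale M" "M ` K \<subseteq> K" "\<exists>k. \<forall>u\<in>K. (M ^^ k) u = 0"
    "\<forall>u. T u = scale l (u + M u)"
proof -
  obtain l w where w: "w \<in> S" "w \<noteq> 0" "T w = scale l w"
    by (rule eigenvector_exists[OF T S])
  have l: "l \<noteq> 0" using w inj by auto
  define M where "M u = scale (1 / l) (T u) - u" for u
  have M: "Vector_Spaces.linear scale scale M"
    by (rule Vector_Spaces.linear_iff[THEN iffD2])
       (simp add: M_def vector_space_axioms T.add T.scale algebra_simps)
  interpret M: Vector_Spaces.linear scale scale M by (rule M)
  have MS: "M ` S \<subseteq> S"
    using S by (auto simp: M_def intro!: subspace_diff subspace_scale)
  obtain k where k: "direct_sum S {u \<in> S. (M ^^ k) u = 0} ((M ^^ k) ` S)"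
    and inj': "\<forall>u\<in>(M ^^ k) ` S. M u = 0 \<longrightarrow> u = 0"
    and Mk: "M ` (M ^^ k) ` S = (M ^^ k) ` S"
    by (rule fitting_decomposition[OF M S(1) MS])
  let ?K = "{u \<in> S. (M ^^ k) u = 0}" and ?I = "(M ^^ k) ` S"
  have TM: "\<forall>u. T u = scale l (u + M u)"
    using l by (simp add: M_def)
  have "M ((M ^^ k) u) = (M ^^ k) (M u)" for u
    by (simp add: funpow_swap1)
  moreover have "(M ^^ j) 0 = 0" for j by (induction j) (auto simp: M.zero)
  ultimately have MK: "M ` ?K \<subseteq> ?K"
    using MS by auto (metis M.zero)
  have sK: "subspace ?K" "subspace ?I" using k by (auto simp: direct_sum_def)
  have TK: "T ` ?K \<subseteq> ?K"
  proof
    fix y assume "y \<in> T ` ?K"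
    then obtain u where u: "u \<in> ?K" "y = T u" by blast
    then have "M u \<in> ?K" using MK by blast
    then show "y \<in> ?K" unfolding u(2) TM[rule_format] by (intro subspace_scale[OF sK(1)] subspace_add[OF sK(1)] u)
  qed
  have TI: "T ` ?I \<subseteq> ?I"
  proof
    fix y assume "y \<in> T ` ?I"
    then obtain u where u: "u \<in> ?I" "y = T u" by blast
    then have "M u \<in> ?I" using Mk by blast
    then show "y \<in> ?I" unfolding u(2) TM[rule_format] by (intro subspace_scale[OF sK(2)] subspace_add[OF sK(2)] u)
  qed
  have "w \<in> ?K"
  proof -
    have "M w = 0" using w l by (simp add: M_def)
    obtain a b where ab: "a \<in> ?K" "b \<in> ?I" "w = a + b"
      using w k unfolding direct_sum_def by blast
    then have "M a + M b = 0" using \<open>M w = 0\<close> by (simp add: M.add)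
    then have "M b = - M a" by (simp add: eq_neg_iff_add_eq_0 add.commute)
    moreover have "M a \<in> ?K" "M b \<in> ?I" using MK Mk ab by auto
    moreover have "- M a \<in> ?K" using sK(1) \<open>M a \<in> ?K\<close> by (rule subspace_neg)
    ultimately have "M b \<in> ?K \<inter> ?I" by simp
    then have "M b = 0" using k unfolding direct_sum_def by blast
    then have "b = 0" using inj' ab(2) by blast
    with ab show ?thesis by simp
  qed
  then have "dim ?K \<noteq> 0" using w by (auto simp: dim_eq_0)
  moreover have "\<forall>u\<in>?K. (M ^^ k) u = 0" by simp
  ultimately show ?thesis
    by (intro that[OF l k TK TI _ M MK _ TM]) blast+
qed

lemma jordan_dim1:
  assumes S: "subspace S" "T ` S \<subseteq> S" "dim S = 1"
    and inj: "\<forall>u\<in>S. T u = 0 \<longrightarrow> u = 0"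
  obtains l e where "l \<noteq> 0" "ordered_basis S [e]" "T e = scale l e"
proof -
  obtain l w where w: "w \<in> S" "w \<noteq> 0" "T w = scale l w"
    by (rule eigenvector_exists[OF T S(1,2)]) (use S(3) in auto)
  have "l \<noteq> 0" using w inj by auto
  moreover have i: "independent {w}" using w by simp
  have "S \<subseteq> span {w}"
    using card_ge_dim_independent[of "{w}" S] i w S by auto
  with S w have "span {w} = S"
    by (intro subset_antisym span_minimal) auto
  with i have "ordered_basis S [w]" by (simp add: ordered_basis_def)
  ultimately show ?thesis using w that by blast
qed

text \<open>
  Split off the generalised eigenspace of one eigenvalue. Either both parts are lines, or
  \<open>T = l (1 + M)\<close> with \<open>M\<close> nilpotent on the whole plane. The same argument, resting on the
  two smaller dimensions, gives dimension three.
\<close>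

lemma jordan_dim2:
  assumes S: "subspace S" "T ` S \<subseteq> S" "dim S = 2"
    and inj: "\<forall>u\<in>S. T u = 0 \<longrightarrow> u = 0"
  obtains l m e1 e2 where "l \<noteq> 0" "m \<noteq> 0" "ordered_basis S [e1, e2]"
      "T e1 = scale l e1" "T e2 = scale m e2"
  | l e1 e2 where "l \<noteq> 0" "ordered_basis S [e1, e2]"
      "T e1 = scale l (e1 + e2)" "T e2 = scale l e2"
proof -
  obtain l M K I where l: "l \<noteq> 0" and KI: "direct_sum S K I"
    and T: "T ` K \<subseteq> K" "T ` I \<subseteq> I" "dim K \<noteq> 0" and
    M: "Vector_Spaces.linear scale scale M" "M ` K \<subseteq> K" "\<exists>k. \<forall>u\<in>K. (M ^^ k) u = 0"
    and TM: "\<forall>u. T u = scale l (u + M u)"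
    by (rule primary_component_split[OF S(1,2) _ inj]) (use S(3) in simp_all)
  have sK: "subspace K" "subspace I" "K \<subseteq> S" "I \<subseteq> S" using KI
    by (auto simp: direct_sum_def subspace_0) (metis add_0 add_0_right subspace_0)+
  have d: "dim K + dim I = 2" using direct_sum_dim[OF KI] S by simp
  consider "dim K = 1" "dim I = 1" | "dim K = 2" "dim I = 0" using d T(3) by linarith
  then show ?thesis
  proof cases
    case 1
    obtain l1 e1 where 1: "l1 \<noteq> 0" "ordered_basis K [e1]" "T e1 = scale l1 e1"
      by (rule jordan_dim1[OF sK(1) T(1) 1(1)]) (use inj sK in blast)
    obtain l2 e2 where 2: "l2 \<noteq> 0" "ordered_basis I [e2]" "T e2 = scale l2 e2"
      by (rule jordan_dim1[OF sK(2) T(2) \<open>dim I = 1\<close>]) (use inj sK in blast)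
    have "ordered_basis S [e1, e2]" using ordered_basis_append[OF KI 1(2) 2(2)] by simp
    with 1 2 show ?thesis by (intro that(1))
  next
    case 2
    then have "I = {0}" using sK(2) by (auto simp: dim_eq_0 subspace_0)
    with KI have "K = S" by (auto simp: direct_sum_def)
    with M have MS: "M ` S \<subseteq> S" "\<exists>k. \<forall>u\<in>S. (M ^^ k) u = 0" by auto
    from nilpotent_dim2[OF M(1) S(1) MS S(3)] show ?thesis
    proof cases
      case 1
      obtain es where es: "ordered_basis S es" using ordered_basis_exists[OF S(1)] by blast
      then have "length es = Suc (Suc 0)" using ordered_basis_dim[OF es] S(3) by simp
      then obtain e1 e2 where "es = [e1, e2]" by (auto simp: length_Suc_conv)
      with es have e: "ordered_basis S [e1, e2]" by simp
      then have "e1 \<in> S" "e2 \<in> S" unfolding ordered_basis_def using span_base by force+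
      with 1 e l that(1)[of l l e1 e2] show ?thesis by (auto simp: TM)
    next
      case (2 w)
      with l that(2)[of l w "M w"] show ?thesis by (auto simp: TM)
    qed
  qed
qed

lemma jordan_dim3:
  assumes S: "subspace S" "T ` S \<subseteq> S" "dim S = 3"
    and inj: "\<forall>u\<in>S. T u = 0 \<longrightarrow> u = 0"
  obtains l m n e1 e2 e3 where "l \<noteq> 0" "m \<noteq> 0" "n \<noteq> 0" "ordered_basis S [e1, e2, e3]"
      "T e1 = scale l e1" "T e2 = scale m e2" "T e3 = scale n e3"
  | l m e1 e2 e3 where "l \<noteq> 0" "m \<noteq> 0" "ordered_basis S [e1, e2, e3]"
      "T e1 = scale l (e1 + e2)" "T e2 = scale l e2" "T e3 = scale m e3"
  | l e1 e2 e3 where "l \<noteq> 0" "ordered_basis S [e1, e2, e3]"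
      "T e1 = scale l (e1 + e2)" "T e2 = scale l (e2 + e3)" "T e3 = scale l e3"
proof -
  obtain l M K I where l: "l \<noteq> 0" and KI: "direct_sum S K I"
    and T: "T ` K \<subseteq> K" "T ` I \<subseteq> I" "dim K \<noteq> 0" and
    M: "Vector_Spaces.linear scale scale M" "M ` K \<subseteq> K" "\<exists>k. \<forall>u\<in>K. (M ^^ k) u = 0"
    and TM: "\<forall>u. T u = scale l (u + M u)"
    by (rule primary_component_split[OF S(1,2) _ inj]) (use S(3) in simp_all)
  have sK: "subspace K" "subspace I" "K \<subseteq> S" "I \<subseteq> S" using KI
    by (auto simp: direct_sum_def subspace_0) (metis add_0 add_0_right subspace_0)+
  have d: "dim K + dim I = 3" using direct_sum_dim[OF KI] S by simp
  note jordan = that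
  have split12: thesis if AB: "direct_sum S A B" "dim A = 2" "dim B = 1"
    and TA: "T ` A \<subseteq> A" "T ` B \<subseteq> B" and sA: "subspace A" "subspace B" "A \<subseteq> S" "B \<subseteq> S" for A B
  proof -
    obtain m e3 where 3: "m \<noteq> 0" "ordered_basis B [e3]" "T e3 = scale m e3"
      by (rule jordan_dim1[OF sA(2) TA(2) AB(3)]) (use inj sA in blast)
    from inj sA have "\<forall>u\<in>A. T u = 0 \<longrightarrow> u = 0" by blast
    from jordan_dim2[OF sA(1) TA(1) AB(2) this] show thesis
    proof cases
      case (1 l1 l2 e1 e2)
      have "ordered_basis S [e1, e2, e3]" using ordered_basis_append[OF AB(1) 1(3) 3(2)] by simp
      with 1 3 show thesis by (intro jordan(1))
    next
      case (2 l e1 e2)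
      have "ordered_basis S [e1, e2, e3]" using ordered_basis_append[OF AB(1) 2(2) 3(2)] by simp
      with 2 3 show thesis by (intro jordan(2))
    qed
  qed
  have IK: "direct_sum S I K" using KI unfolding direct_sum_def
    by (auto simp: Int_commute) (metis add.commute)+
  consider "dim K = 1" "dim I = 2" | "dim K = 2" "dim I = 1" | "dim K = 3" "dim I = 0"
    using d T(3) by linarith
  then show ?thesis
  proof cases
    case 1
    then show ?thesis by (intro split12[OF IK _ _ T(2,1) sK(2,1,4,3)])
  next
    case 2
    then show ?thesis by (intro split12[OF KI _ _ T(1,2) sK])
  next
    case 3
    then have "I = {0}" using sK(2) by (auto simp: dim_eq_0 subspace_0)
    with KI have "K = S" by (auto simp: direct_sum_def)
    with M have MS: "M ` S \<subseteq> S" "\<exists>k. \<forall>u\<in>S. (M ^^ k) u = 0" by auto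
    from nilpotent_dim3[OF M(1) S(1) MS S(3)] show ?thesis
    proof cases
      case 1
      obtain es where es: "ordered_basis S es" using ordered_basis_exists[OF S(1)] by blast
      then have "length es = Suc (Suc (Suc 0))" using ordered_basis_dim[OF es] S(3) by simp
      then obtain e1 e2 e3 where "es = [e1, e2, e3]" by (auto simp: length_Suc_conv)
      with es have e: "ordered_basis S [e1, e2, e3]" by simp
      then have "e1 \<in> S" "e2 \<in> S" "e3 \<in> S" unfolding ordered_basis_def using span_base by force+
      with 1 e l that(1)[of l l l e1 e2 e3] show ?thesis by (auto simp: TM)
    next
      case (2 w z)
      with l that(2)[of l l w "M w" z] show ?thesis by (auto simp: TM)
    next
      case (3 w)
      with l that(3)[of l w "M w" "M (M w)"] show ?thesis by (auto simp: TM)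
    qed
  qed
qed

end

end

section \<open>The multiplication tables\<close>

lemma mult_table_radical_abelian: "i \<noteq> X \<Longrightarrow> j \<noteq> X \<Longrightarrow> mult_table p (i, j) = 0"
  by (cases p) simp_all

lemma mult_table_in_radical: "mult_table p (i, j) $ X = 0"
  by (cases p) (simp_all add: e_nth)

lemma sum_gen: "(\<Sum>i\<in>UNIV. f i) = f X + f E1 + f E2 + f E3"
  by (simp add: UNIV_gen add_ac)

lemma all_gen: "(\<forall>k. P k) \<longleftrightarrow> P X \<and> P E1 \<and> P E2 \<and> P E3"
  by (metis gen.exhaust)

section \<open>Extensions of an abelian ideal by one element\<close>

text \<open>
  A Leibniz algebra spanned by an abelian ideal of dimension three and one more vector \<open>x\<close>. That
  \<open>[_, x]\<close> is not nilpotent on \<open>N\<close> is what remains of the maximality of the nilradical.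
\<close>

locale leibniz_extension = complex_fd_space scale Basis + leibniz_algebra scale bracket
  for scale :: "complex \<Rightarrow> 'a::ab_group_add \<Rightarrow> 'a" and Basis bracket +
  fixes N :: "'a set" and x :: 'a
  assumes N_subspace: "subspace N"
    and N_dim: "dim N = 3"
    and x_notin: "x \<notin> N"
    and decompose: "\<exists>a. \<exists>n\<in>N. u = scale a x + n"
    and N_abelian: "a \<in> N \<Longrightarrow> b \<in> N \<Longrightarrow> bracket a b = 0"
    and N_right: "n \<in> N \<Longrightarrow> bracket n u \<in> N"
    and N_left: "n \<in> N \<Longrightarrow> bracket u n \<in> N"
    and xx: "bracket x x \<in> N"
    and D_not_nilpotent: "\<exists>n\<in>N. ((\<lambda>n. bracket n x) ^^ k) n \<noteq> 0"
begin

abbreviation D :: "'a \<Rightarrow> 'a" where "D u \<equiv> bracket u x"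
abbreviation A :: "'a \<Rightarrow> 'a" where "A u \<equiv> bracket x u"
abbreviation B :: "'a \<Rightarrow> 'a" where "B u \<equiv> A u + D u"

sublocale brl: Vector_Spaces.linear scale scale "\<lambda>u. bracket u y" for y by (rule linear_left)
sublocale brr: Vector_Spaces.linear scale scale "bracket y" for y by (rule linear_right)

lemma A_D_commute: "n \<in> N \<Longrightarrow> A (D n) = D (A n)"
  using leibniz_identity[of x n x] N_abelian[OF xx] by simp

lemma A_A: "n \<in> N \<Longrightarrow> A (A n) = - D (A n)"
  using leibniz_identity[of x x n] N_abelian[OF xx] by simp

lemma A_B: "n \<in> N \<Longrightarrow> A (B n) = 0"
  by (simp add: brr.add A_A A_D_commute)

lemma A_xx: "A (bracket x x) = 0"
  using leibniz_identity[of x x x] by simp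

text \<open>
  The vectors \<open>[x', x']\<close> for all choices \<open>x' \<in> x + N\<close>. They form a coset of the image of \<open>B\<close>, so
  \<open>B u\<close> with \<open>u \<in> N\<close> may be added freely.
\<close>

definition squares :: "'a set" where
  "squares = {bracket (x + u) (x + u) | u. u \<in> N}"

lemma square_shift: "u \<in> N \<Longrightarrow> bracket (x + u) (x + u) = bracket x x + B u"
  by (simp add: brl.add brr.add N_abelian add_ac)

lemma squares_shift:
  assumes "w \<in> squares" "u \<in> N"
  shows "w + B u \<in> squares"
proof -
  obtain v where v: "v \<in> N" "w = bracket x x + B v"
    using assms(1) square_shift by (auto simp: squares_def)
  have "w + B u = bracket x x + B (v + u)"
    using v by (simp add: brl.add brr.add add_ac)
  also have "\<dots> = bracket (x + (v + u)) (x + (v + u))"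
    using v(1) assms(2) by (intro square_shift[symmetric] subspace_add[OF N_subspace])
  finally show ?thesis
    using v(1) assms(2) subspace_add[OF N_subspace] unfolding squares_def by blast
qed

lemma A_squares:
  assumes "w \<in> squares" shows "A w = 0"
proof -
  obtain v where "v \<in> N" "w = bracket x x + B v"
    using assms square_shift by (auto simp: squares_def)
  then show ?thesis using A_B[of v] by (simp add: brr.add A_xx)
qed

lemma D_funpow: "(D ^^ k) (D u) = D ((D ^^ k) u)"
  by (rule funpow_swap1[symmetric])

lemma D_pow_A: "n \<in> N \<Longrightarrow> (D ^^ k) n \<in> N \<and> (D ^^ k) (A n) = A ((D ^^ k) n)"
  by (induction k) (auto simp: N_right A_D_commute)

text \<open>
  Follows from \<open>A\<^sup>2 = - D A\<close>. It makes \<open>A\<close> nilpotent wherever \<open>D\<close> is.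
\<close>

lemma A_pow: "n \<in> N \<Longrightarrow> (A ^^ Suc j) n = scale ((-1) ^ j) ((D ^^ j) (A n))"
proof (induction j)
  case (Suc j)
  interpret Dj: Vector_Spaces.linear scale scale "D ^^ j"
    by (rule funpow_linear[OF linear_left])
  have "(A ^^ Suc (Suc j)) n = A ((A ^^ Suc j) n)" by simp
  also have "\<dots> = scale ((-1) ^ j) (A ((D ^^ j) (A n)))"
    by (simp only: Suc brr.scale)
  also have "A ((D ^^ j) (A n)) = (D ^^ j) (A (A n))"
    using D_pow_A[of "A n" j] Suc.prems N_left by simp
  also have "\<dots> = - (D ^^ Suc j) (A n)"
    using A_A[OF Suc.prems] by (simp add: Dj.neg D_funpow)
  finally show ?case by simp
qed simp

text \<open>
  On the part \<open>N1\<close> where \<open>D = B - A\<close> is invertible, every vector is \<open>D y = B y - A y\<close>, so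
  \<open>N1 = A N1 + B N1\<close>. The relations \<open>A B = B A = 0\<close> give \<open>A = - D\<close> on \<open>A N1\<close> and \<open>A = 0\<close> on
  \<open>B N1\<close>, and a common vector of both is killed by \<open>D\<close>, hence zero. The component of \<open>[x, x]\<close> in
  \<open>N1\<close> is \<open>D y\<close> for some \<open>y\<close>; from \<open>A [x, x] = 0\<close> follows \<open>A y = 0\<close>, so that this component equals
  \<open>B y\<close> and is removed by replacing \<open>x\<close> with \<open>x - y\<close>.
\<close>

lemma weight_decomposition:
  obtains N0 NA NB w where
    "\<exists>N1. direct_sum N N0 N1 \<and> direct_sum N1 NA NB"
    "D ` N0 \<subseteq> N0" "D ` NA \<subseteq> NA" "D ` NB \<subseteq> NB" "A ` N0 \<subseteq> N0"
    "\<exists>k. \<forall>u\<in>N0. (D ^^ k) u = 0" "\<exists>k. \<forall>u\<in>N0. (A ^^ k) u = 0"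
    "\<forall>u\<in>NA. D u = 0 \<longrightarrow> u = 0" "\<forall>u\<in>NB. D u = 0 \<longrightarrow> u = 0"
    "\<forall>u\<in>NA. A u = - D u" "\<forall>u\<in>NB. A u = 0"
    "w \<in> N0" "w \<in> squares" "dim NA + dim NB \<noteq> 0"
proof -
  have DN: "D ` N \<subseteq> N" using N_right by auto
  obtain k where dN: "direct_sum N {u \<in> N. (D ^^ k) u = 0} ((D ^^ k) ` N)"
    and inj: "\<forall>u\<in>(D ^^ k) ` N. D u = 0 \<longrightarrow> u = 0"
    and surj: "D ` (D ^^ k) ` N = (D ^^ k) ` N"
    by (rule fitting_decomposition[OF linear_left N_subspace DN])
  define N0 where "N0 = {u \<in> N. (D ^^ k) u = 0}"
  define N1 where "N1 = (D ^^ k) ` N"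
  define NA where "NA = A ` N1"
  define NB where "NB = B ` N1"
  have d1: "direct_sum N N0 N1" using dN by (simp add: N0_def N1_def)
  have inj1: "u = 0" if "u \<in> N1" "D u = 0" for u using inj that by (auto simp: N1_def)
  have surj1: "D ` N1 = N1" using surj by (simp add: N1_def)
  have s: "subspace N0" "subspace N1" using d1 by (auto simp: direct_sum_def)
  have N1N: "N1 \<subseteq> N" unfolding N1_def by (rule funpow_invariant[OF DN])
  have AN1: "A u \<in> N1" if "u \<in> N1" for u
  proof -
    from that obtain n where n: "n \<in> N" "u = (D ^^ k) n" by (auto simp: N1_def)
    then have "A u = (D ^^ k) (A n)" using D_pow_A by simp
    with n N_left show ?thesis by (simp add: N1_def)
  qed
  have DN1: "D u \<in> N1" if "u \<in> N1" for u using that surj1 by auto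
  have AN0: "A u \<in> N0" if "u \<in> N0" for u
    using that D_pow_A[of u k] N_left by (simp add: N0_def brr.zero)
  have DN0: "D u \<in> N0" if "u \<in> N0" for u
    using that N_right by (simp add: N0_def brl.zero D_funpow)
  interpret B: Vector_Spaces.linear scale scale B
    by (rule Vector_Spaces.linear_iff[THEN iffD2])
       (simp add: vector_space_axioms brl.add brr.add brl.scale brr.scale algebra_simps)
  have AA: "A (A u) = - D (A u)" "A (D u) = D (A u)" "A (B u) = 0" if "u \<in> N1" for u
    using that N1N A_A A_D_commute A_B by blast+
  have sAB: "subspace NA" "subspace NB" unfolding NA_def NB_def
    using s(2) brr.subspace_image B.subspace_image by auto
  have BN1: "B u \<in> N1" if "u \<in> N1" for u
    using AN1 DN1 s(2) that by (auto intro: subspace_add)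
  have NAD: "A u = - D u" "u \<in> N1" if "u \<in> NA" for u
    using that AA AN1 by (auto simp: NA_def)
  have NBD: "A u = 0" "u \<in> N1" if "u \<in> NB" for u
    using that AA BN1 by (auto simp: NB_def)
  have d2: "direct_sum N1 NA NB"
    unfolding direct_sum_def
  proof (intro conjI sAB)
    show "NA \<inter> NB = {0}"
      using NAD NBD inj1 sAB by (auto simp: subspace_0) (metis neg_0_equal_iff_equal)
    have "u \<in> {a + b |a b. a \<in> NA \<and> b \<in> NB}" if "u \<in> N1" for u
    proof -
      from that surj1 obtain y where y: "y \<in> N1" "u = D y" by blast
      have "- A y \<in> NA" using sAB(1) y by (auto simp: NA_def intro: subspace_neg)
      moreover have "B y \<in> NB" using y by (auto simp: NB_def)
      moreover have "u = - A y + B y" by (simp add: y)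
      ultimately show ?thesis by blast
    qed
    then show "N1 = {a + b |a b. a \<in> NA \<and> b \<in> NB}"
      using NAD(2) NBD(2) s(2) by (auto intro: subspace_add)
  qed
  have DA: "D ` NA \<subseteq> NA"
  proof -
    have "D (A u) \<in> NA" if "u \<in> N1" for u
      using AA(2)[OF that] DN1[OF that] unfolding NA_def by (metis imageI)
    then show ?thesis by (auto simp: NA_def)
  qed
  have DB: "D ` NB \<subseteq> NB"
  proof -
    have "D (B u) = B (D u)" if "u \<in> N1" for u
      using AA(2)[OF that] by (simp add: brl.add)
    then have "D (B u) \<in> NB" if "u \<in> N1" for u
      using DN1 that unfolding NB_def by (metis (no_types, lifting) imageI)
    then show ?thesis by (auto simp: NB_def)
  qed
  have nilA: "\<forall>u\<in>N0. (A ^^ Suc k) u = 0"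
  proof
    fix u assume u: "u \<in> N0"
    then have "(D ^^ k) (A u) = 0" using AN0 by (simp add: N0_def)
    then show "(A ^^ Suc k) u = 0" using A_pow[of u k] u by (simp add: N0_def)
  qed
  obtain v0 v1 where v: "v0 \<in> N0" "v1 \<in> N1" "bracket x x = v0 + v1"
    using xx d1 unfolding direct_sum_def by blast
  have "A v0 + A v1 = 0" using A_xx v by (simp add: brr.add)
  then have "A v1 = - A v0" by (simp add: eq_neg_iff_add_eq_0 add.commute)
  moreover have "- A v0 \<in> N0" using AN0 v s by (auto intro: subspace_neg)
  ultimately have "A v1 \<in> N0 \<inter> N1" using AN1[OF v(2)] by auto
  then have Av1: "A v1 = 0" using d1 by (auto simp: direct_sum_def)
  obtain y where y: "y \<in> N1" "v1 = D y" using v surj1 by blast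
  then have "A y = 0" using Av1 inj1[of "A y"] AA AN1 by auto
  then have v0: "v0 = bracket x x + B (- y)" using v y by (simp add: brr.neg brl.neg)
  have "- y \<in> N" using y N1N N_subspace by (auto intro: subspace_neg)
  then have "v0 \<in> squares"
    unfolding v0 square_shift[OF \<open>- y \<in> N\<close>, symmetric] squares_def by blast
  moreover have "dim NA + dim NB \<noteq> 0"
  proof
    assume "dim NA + dim NB = 0"
    then have "NA \<subseteq> {0}" "NB \<subseteq> {0}" by (auto simp: dim_eq_0)
    then have "NA = {0}" "NB = {0}" using sAB subspace_0 by blast+
    then have "N1 \<subseteq> {0}" using d2 by (auto simp: direct_sum_def)
    then show False using D_not_nilpotent[of k] by (auto simp: N1_def)
  qed
  moreover have "\<forall>u\<in>N0. (D ^^ k) u = 0" by (simp add: N0_def)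
  moreover have "D ` N0 \<subseteq> N0" "A ` N0 \<subseteq> N0" using DN0 AN0 by auto
  moreover have "\<forall>u\<in>NA. D u = 0 \<longrightarrow> u = 0" "\<forall>u\<in>NB. D u = 0 \<longrightarrow> u = 0"
    using NAD NBD inj1 by auto
  ultimately show ?thesis
    using d1 d2 DA DB nilA NAD(1) NBD(1) v(1)
    by (intro that[of N0 NA NB v0] exI[of _ N1] exI[of _ k] exI[of _ "Suc k"] conjI ballI) simp_all
qed

end

context leibniz_extension
begin

definition classified :: bool where
  "classified \<longleftrightarrow>
     (\<exists>p. admissible p \<and> isomorphic_algebras scale bracket (*s) (table_bracket (mult_table p)))"

text \<open>
  To recognise the table \<open>p\<close> it is enough to compare the operators \<open>c D\<close>, \<open>c A\<close> and some vector
  \<open>c\<^sup>2 w\<close>, \<open>w \<in> squares\<close>, with the columns of \<open>p\<close>. If \<open>w = [x + n, x + n]\<close>, the basis that realises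
  the table is \<open>c (x + n), e1, e2, e3\<close>: the vector \<open>n\<close> does not affect products with elements of
  \<open>N\<close>. The function \<open>F\<close> abbreviates linear combinations of \<open>e1, e2, e3\<close>.
\<close>

lemma classifiedI:
  assumes p: "admissible p" and c: "c \<noteq> 0"
    and basis: "ordered_basis N [e1, e2, e3]"
    and w: "w \<in> squares"
    and F: "\<And>u. F u = scale (u $ E1) e1 + scale (u $ E2) e2 + scale (u $ E3) e3"
    and D: "scale c (D e1) = F (mult_table p (E1, X))" "scale c (D e2) = F (mult_table p (E2, X))"
      "scale c (D e3) = F (mult_table p (E3, X))"
    and A: "scale c (A e1) = F (mult_table p (X, E1))" "scale c (A e2) = F (mult_table p (X, E2))"
      "scale c (A e3) = F (mult_table p (X, E3))"
    and ww: "scale (c\<^sup>2) w = F (mult_table p (X, X))"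
  shows classified
proof -
  obtain n where n: "n \<in> N" "w = bracket (x + n) (x + n)"
    using w by (auto simp: squares_def)
  define y where "y = scale c (x + n)"
  have eN: "e1 \<in> N" "e2 \<in> N" "e3 \<in> N"
    using basis span_superset[of "{e1, e2, e3}"] by (auto simp: ordered_basis_def)
  define g where "g = case_gen y e1 e2 e3"
  define f where "f u = (\<Sum>i\<in>UNIV. scale (u $ i) (g i))" for u :: "complex ^ gen"
  have f: "f u = scale (u $ X) y + F u" for u
    by (simp add: f_def sum_gen g_def F add_ac)
  have lin: "Vector_Spaces.linear (*s) scale f"
    by (rule Vector_Spaces.linear_iff[THEN iffD2])
       (simp add: vector_space_axioms vec.vector_space_axioms f_def scale_left_distrib
         sum.distrib scale_sum_right)
  interpret f: Vector_Spaces.linear "(*s)" scale f by (rule lin)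
  have fT: "f (mult_table p (i, j)) = bracket (g i) (g j)" for i j
  proof (cases "i = X"; cases "j = X")
    assume "i = X" "j = X"
    then show ?thesis
      using ww n by (simp add: f mult_table_in_radical g_def y_def brl.scale brr.scale power2_eq_square)
  next
    assume "i = X" "j \<noteq> X"
    then show ?thesis
      using A n eN by (cases j) (simp_all add: f mult_table_in_radical g_def y_def brl.scale brl.add N_abelian)
  next
    assume "i \<noteq> X" "j = X"
    then show ?thesis
      using D n eN by (cases i) (simp_all add: f mult_table_in_radical g_def y_def brr.scale brr.add N_abelian)
  next
    assume ij: "i \<noteq> X" "j \<noteq> X"
    then have "g i \<in> N" "g j \<in> N" using eN by (cases i; cases j; simp add: g_def)+
    then show ?thesis using ij by (simp add: mult_table_radical_abelian N_abelian f.zero)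
  qed
  have hom: "f (table_bracket (mult_table p) u v) = bracket (f u) (f v)" for u v
    by (simp add: table_bracket_def f.sum f.scale fT)
       (simp add: f_def brl.sum brr.sum brl.scale brr.scale scale_sum_right mult.commute,
        rule sum.swap)
  have Fu: "F u \<in> N" for u
    using eN N_subspace by (simp add: F subspace_add subspace_scale)
  have "inj f"
    unfolding f.inj_iff_eq_0
  proof (intro allI impI)
    fix u assume fu: "f u = 0"
    have "u $ X = 0"
    proof (rule ccontr)
      assume u: "u $ X \<noteq> 0"
      let ?s = "u $ X * c"
      have "scale ?s x + (scale ?s n + F u) = 0"
        using fu by (simp add: f y_def scale_right_distrib add_ac)
      then have "scale (1 / ?s) (scale ?s x + (scale ?s n + F u)) = 0" by simp
      then have "x + scale (1 / ?s) (scale ?s n + F u) = 0"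
        using u c by (simp add: scale_right_distrib)
      then have "x = - scale (1 / ?s) (scale ?s n + F u)"
        by (simp add: eq_neg_iff_add_eq_0)
      also have "\<dots> \<in> N"
        using Fu n by (intro subspace_neg[OF N_subspace] subspace_scale[OF N_subspace]
            subspace_add[OF N_subspace])
      finally show False using x_notin by simp
    qed
    with fu have "F u = 0" by (simp add: f)
    then have "u $ E1 = 0 \<and> u $ E2 = 0 \<and> u $ E3 = 0"
      unfolding F by (rule ordered_basis3_indep[OF basis])
    with \<open>u $ X = 0\<close> show "u = 0"
      by (simp add: vec_eq_iff) (metis gen.exhaust)
  qed
  moreover have "surj f"
  proof -
    have "\<exists>v. u = f v" for u
    proof -
      obtain a m where am: "m \<in> N" "u = scale a x + m" using decompose by blast
      have "m - scale a n \<in> N"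
        using am n by (intro subspace_diff[OF N_subspace] subspace_scale[OF N_subspace])
      then obtain b1 b2 b3 where b: "m - scale a n = scale b1 e1 + scale b2 e2 + scale b3 e3"
        by (rule ordered_basis3_coords[OF basis])
      define v :: "complex ^ gen" where "v = (\<chi> i. case_gen (a / c) b1 b2 b3 i)"
      have "f v = scale a (x + n) + (m - scale a n)"
        using c by (simp add: f F v_def y_def b)
      with am show ?thesis by (intro exI[of _ v]) (simp add: scale_right_distrib)
    qed
    then show ?thesis by auto
  qed
  ultimately have bij: "bij f" by (simp add: bij_def)
  then have fi: "f (inv f u) = u" "inv f (f v) = v" for u v
    by (simp_all add: bij_is_surj surj_f_inv_f bij_is_inj)
  have "inv f (a + b) = inv f a + inv f b" for a b
    by (metis fi f.add)
  moreover have "inv f (scale r b) = r *s inv f b" for r b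
    by (metis fi f.scale)
  ultimately have "Vector_Spaces.linear scale (*s) (inv f)"
    by (intro Vector_Spaces.linear_iff[THEN iffD2])
       (simp add: vector_space_axioms vec.vector_space_axioms)
  moreover have "bij (inv f)" using bij by (rule bij_imp_bij_inv)
  moreover have "inv f (bracket u v) = table_bracket (mult_table p) (inv f u) (inv f v)" for u v
    by (metis fi hom)
  ultimately show ?thesis
    using p unfolding classified_def isomorphic_algebras_def by blast
qed

end

section \<open>Reading off the table\<close>

context leibniz_extension
begin

context
  fixes N0 N1 NA NB w
  assumes N01: "direct_sum N N0 N1" and NAB: "direct_sum N1 NA NB"
    and DN0: "D ` N0 \<subseteq> N0" and DNA: "D ` NA \<subseteq> NA" and DNB: "D ` NB \<subseteq> NB" and AN0: "A ` N0 \<subseteq> N0"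
    and nilD: "\<exists>k. \<forall>u\<in>N0. (D ^^ k) u = 0" and nilA: "\<exists>k. \<forall>u\<in>N0. (A ^^ k) u = 0"
    and injA: "\<forall>u\<in>NA. D u = 0 \<longrightarrow> u = 0" and injB: "\<forall>u\<in>NB. D u = 0 \<longrightarrow> u = 0"
    and A_on_NA: "\<forall>u\<in>NA. A u = - D u" and A_on_NB: "\<forall>u\<in>NB. A u = 0"
    and w0: "w \<in> N0" and w: "w \<in> squares"
    and AB: "dim NA + dim NB \<noteq> 0"
begin

lemma weight_subspaces: "subspace N0" "subspace NA" "subspace NB"
  using N01 NAB by (auto simp: direct_sum_def)

lemma weight_dims: "dim N0 + dim NA + dim NB = 3"
  using direct_sum_dim[OF N01] direct_sum_dim[OF NAB] N_dim by simp

lemma Nil_bases: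
  "dim N0 = 0 \<Longrightarrow> ordered_basis N0 []" "dim NA = 0 \<Longrightarrow> ordered_basis NA []"
  "dim NB = 0 \<Longrightarrow> ordered_basis NB []"
  using ordered_basis_Nil weight_subspaces by auto

lemma weight_basis3:
  assumes "ordered_basis N0 es" "ordered_basis NA as" "ordered_basis NB bs"
  shows "ordered_basis N (es @ as @ bs)"
  using ordered_basis_append[OF N01 assms(1) ordered_basis_append[OF NAB assms(2,3)]] .

text \<open>
  If \<open>D\<close> is invertible, \<open>[x, x]\<close> is moved to \<open>0\<close> and the algebra is given by the Jordan forms of \<open>D\<close>
  on \<open>NA\<close> and \<open>NB\<close>. A Jordan block must be listed first in the tables, so its eigenvalue is the one
  that becomes 1; otherwise this is an eigenvalue on \<open>NA\<close>, if there is one.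
\<close>

lemma classified_invertible:
  assumes d0: "dim N0 = 0"
  shows classified
proof -
  have "w = 0" using d0 w0 by (auto simp: dim_eq_0)
  with w have w: "0 \<in> squares" by simp
  note b0 = Nil_bases(1)[OF d0]
  note simps = e_nth scale_right_distrib scale_right_diff_distrib
  have "dim NA + dim NB = 3" using weight_dims d0 by simp
  then consider "dim NA = 3" "dim NB = 0" | "dim NA = 2" "dim NB = 1"
    | "dim NA = 1" "dim NB = 2" | "dim NA = 0" "dim NB = 3" by linarith
  then show ?thesis
  proof cases
    case 1
    from jordan_dim3[OF linear_left weight_subspaces(2) DNA 1(1) injA] show ?thesis
    proof cases
      case *: (1 l m n e1 e2 e3)
      then have A: "A e1 = - D e1" "A e2 = - D e2" "A e3 = - D e3"
        using A_on_NA ordered_basis_mem[OF *(4)] by auto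
      have "ordered_basis N [e1, e2, e3]" using weight_basis3[OF b0 *(4) Nil_bases(3)[OF 1(2)]] by simp
      from classifiedI[OF _ _ this w HOL.refl, of "L20 (m / l) (n / l)" "1 / l"] show ?thesis
        using * A by (simp add: simps)
    next
      case *: (2 l m e1 e2 e3)
      then have A: "A e1 = - D e1" "A e2 = - D e2" "A e3 = - D e3"
        using A_on_NA ordered_basis_mem[OF *(3)] by auto
      have "ordered_basis N [e1, e2, e3]" using weight_basis3[OF b0 *(3) Nil_bases(3)[OF 1(2)]] by simp
      from classifiedI[OF _ _ this w HOL.refl, of "L31 (m / l)" "1 / l"] show ?thesis
        using * A by (simp add: simps)
    next
      case *: (3 l e1 e2 e3)
      then have A: "A e1 = - D e1" "A e2 = - D e2" "A e3 = - D e3"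
        using A_on_NA ordered_basis_mem[OF *(2)] by auto
      have "ordered_basis N [e1, e2, e3]" using weight_basis3[OF b0 *(2) Nil_bases(3)[OF 1(2)]] by simp
      from classifiedI[OF _ _ this w HOL.refl, of "L42" "1 / l"] show ?thesis
        using * A by (simp add: simps)
    qed
  next
    case 2
    obtain n b where b: "n \<noteq> 0" "ordered_basis NB [b]" "D b = scale n b"
      by (rule jordan_dim1[OF linear_left weight_subspaces(3) DNB 2(2) injB])
    have Ab: "A b = 0" using A_on_NB ordered_basis_mem[OF b(2)] by auto
    from jordan_dim2[OF linear_left weight_subspaces(2) DNA 2(1) injA] show ?thesis
    proof cases
      case *: (1 l m e1 e2)
      then have A: "A e1 = - D e1" "A e2 = - D e2"
        using A_on_NA ordered_basis_mem[OF *(3)] by auto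
      have "ordered_basis N [e1, e2, b]" using weight_basis3[OF b0 *(3) b(2)] by simp
      from classifiedI[OF _ _ this w HOL.refl, of "L21 (m / l) (n / l)" "1 / l"] show ?thesis
        using * A b Ab by (simp add: simps)
    next
      case *: (2 l e1 e2)
      then have A: "A e1 = - D e1" "A e2 = - D e2"
        using A_on_NA ordered_basis_mem[OF *(2)] by auto
      have "ordered_basis N [e1, e2, b]" using weight_basis3[OF b0 *(2) b(2)] by simp
      from classifiedI[OF _ _ this w HOL.refl, of "L29 (n / l)" "1 / l"] show ?thesis
        using * A b Ab by (simp add: simps)
    qed
  next
    case 3
    obtain n a where a: "n \<noteq> 0" "ordered_basis NA [a]" "D a = scale n a"
      by (rule jordan_dim1[OF linear_left weight_subspaces(2) DNA 3(1) injA])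
    have Aa: "A a = - D a" using A_on_NA ordered_basis_mem[OF a(2)] by auto
    from jordan_dim2[OF linear_left weight_subspaces(3) DNB 3(2) injB] show ?thesis
    proof cases
      case *: (1 l m e1 e2)
      then have A: "A e1 = 0" "A e2 = 0"
        using A_on_NB ordered_basis_mem[OF *(3)] by auto
      have "ordered_basis N [a, e1, e2]" using weight_basis3[OF b0 a(2) *(3)] by simp
      from classifiedI[OF _ _ this w HOL.refl, of "L22 (l / n) (m / n)" "1 / n"] show ?thesis
        using * A a Aa by (simp add: simps)
    next
      case *: (2 l e1 e2)
      then have A: "A e1 = 0" "A e2 = 0"
        using A_on_NB ordered_basis_mem[OF *(2)] by auto
      have "ordered_basis N [a, e1, e2]" using weight_basis3[OF b0 a(2) *(2)] by simp
      then have "ordered_basis N [e1, e2, a]" by (rule ordered_basis3_rotate)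
      from classifiedI[OF _ _ this w HOL.refl, of "L34 (n / l)" "1 / l"] show ?thesis
        using * A a Aa by (simp add: simps)
    qed
  next
    case 4
    from jordan_dim3[OF linear_left weight_subspaces(3) DNB 4(2) injB] show ?thesis
    proof cases
      case *: (1 l m n e1 e2 e3)
      then have A: "A e1 = 0" "A e2 = 0" "A e3 = 0"
        using A_on_NB ordered_basis_mem[OF *(4)] by auto
      have "ordered_basis N [e1, e2, e3]" using weight_basis3[OF b0 Nil_bases(2)[OF 4(1)] *(4)] by simp
      from classifiedI[OF _ _ this w HOL.refl, of "L23 (m / l) (n / l)" "1 / l"] show ?thesis
        using * A by (simp add: simps)
    next
      case *: (2 l m e1 e2 e3)
      then have A: "A e1 = 0" "A e2 = 0" "A e3 = 0"
        using A_on_NB ordered_basis_mem[OF *(3)] by auto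
      have "ordered_basis N [e1, e2, e3]" using weight_basis3[OF b0 Nil_bases(2)[OF 4(1)] *(3)] by simp
      from classifiedI[OF _ _ this w HOL.refl, of "L32 (m / l)" "1 / l"] show ?thesis
        using * A by (simp add: simps)
    next
      case *: (3 l e1 e2 e3)
      then have A: "A e1 = 0" "A e2 = 0" "A e3 = 0"
        using A_on_NB ordered_basis_mem[OF *(2)] by auto
      have "ordered_basis N [e1, e2, e3]" using weight_basis3[OF b0 Nil_bases(2)[OF 4(1)] *(2)] by simp
      from classifiedI[OF _ _ this w HOL.refl, of "L41" "1 / l"] show ?thesis
        using * A by (simp add: simps)
    qed
  qed
qed

text \<open>
  On the line \<open>N0\<close> the nilpotent operators \<open>D\<close> and \<open>A\<close> vanish. If \<open>w = 0\<close>, the table belongs to a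
  diagonal or Jordan family with one eigenvalue equal to \<open>0\<close>; otherwise \<open>w\<close> spans the line, and
  \<open>c\<^sup>2 w\<close> serves as the basis vector \<open>e3 = [x, x]\<close>.
\<close>

lemma classified_nil_dim1:
  assumes d0: "dim N0 = 1"
  shows classified
proof -
  have D0: "D u = 0" and A0: "A u = 0" if "u \<in> N0" for u
    using nilpotent_dim1[OF linear_left weight_subspaces(1) DN0 nilD d0 that]
      nilpotent_dim1[OF linear_right weight_subspaces(1) AN0 nilA d0 that] by auto
  obtain es where es: "ordered_basis N0 es" using ordered_basis_exists[OF weight_subspaces(1)] by blast
  moreover have "length es = Suc 0" using ordered_basis_dim[OF es] d0 by simp
  ultimately obtain e where e: "ordered_basis N0 [e]" by (auto simp: length_Suc_conv)
  have bw: "ordered_basis N0 [w]" if "w \<noteq> 0"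
  proof -
    have "independent {w}" using that by simp
    then have "N0 \<subseteq> span {w}" using card_ge_dim_independent[of "{w}" N0] w0 d0 by auto
    then have "span {w} = N0" using w0 weight_subspaces(1) by (intro subset_antisym span_minimal) auto
    with that show ?thesis by (simp add: ordered_basis_def)
  qed
  obtain f where f: "ordered_basis N0 [f]" "w = 0 \<or> w = f" using bw e by blast
  have f0: "D f = 0" "A f = 0" using D0 A0 ordered_basis_mem[OF f(1)] by auto
  note simps = e_nth scale_right_distrib scale_right_diff_distrib
  have "dim NA + dim NB = 2" using weight_dims d0 by simp
  then consider "dim NA = 2" "dim NB = 0" | "dim NA = 1" "dim NB = 1"
    | "dim NA = 0" "dim NB = 2" by linarith
  then show ?thesis
  proof cases
    case 1
    from jordan_dim2[OF linear_left weight_subspaces(2) DNA 1(1) injA] show ?thesis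
    proof cases
      case *: (1 l m e1 e2)
      then have A: "A e1 = - D e1" "A e2 = - D e2"
        using A_on_NA ordered_basis_mem[OF *(3)] by auto
      have "ordered_basis N [f, e1, e2]" using weight_basis3[OF f(1) *(3) Nil_bases(3)[OF 1(2)]] by simp
      then have b: "ordered_basis N [e1, e2, f]" by (rule ordered_basis3_rotate)
      show ?thesis
      proof (cases "w = 0")
        case True
        from classifiedI[OF _ _ b w HOL.refl, of "L20 (m / l) 0" "1 / l"] show ?thesis
          using * A f0 True by (simp add: simps)
      next
        case False
        then have "w = f" using f by simp
        have "ordered_basis N [scale 1 e1, scale 1 e2, scale ((1 / l)\<^sup>2) f]"
          using * by (intro ordered_basis3_scale[OF b]) auto
        from classifiedI[OF _ _ this w HOL.refl, of "L24 (m / l)" "1 / l"] show ?thesis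
          using * A f0 \<open>w = f\<close> by (simp add: simps brl.scale brr.scale)
      qed
    next
      case *: (2 l e1 e2)
      then have A: "A e1 = - D e1" "A e2 = - D e2"
        using A_on_NA ordered_basis_mem[OF *(2)] by auto
      have "ordered_basis N [f, e1, e2]" using weight_basis3[OF f(1) *(2) Nil_bases(3)[OF 1(2)]] by simp
      then have b: "ordered_basis N [e1, e2, f]" by (rule ordered_basis3_rotate)
      show ?thesis
      proof (cases "w = 0")
        case True
        from classifiedI[OF _ _ b w HOL.refl, of "L29 0" "1 / l"] show ?thesis
          using * A f0 True by (simp add: simps)
      next
        case False
        then have "w = f" using f by simp
        have "ordered_basis N [scale 1 e1, scale 1 e2, scale ((1 / l)\<^sup>2) f]"
          using * by (intro ordered_basis3_scale[OF b]) auto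
        from classifiedI[OF _ _ this w HOL.refl, of "L30" "1 / l"] show ?thesis
          using * A f0 \<open>w = f\<close> by (simp add: simps brl.scale brr.scale)
      qed
    qed
  next
    case 2
    obtain m b where b: "m \<noteq> 0" "ordered_basis NB [b]" "D b = scale m b"
      by (rule jordan_dim1[OF linear_left weight_subspaces(3) DNB 2(2) injB])
    obtain l a where a: "l \<noteq> 0" "ordered_basis NA [a]" "D a = scale l a"
      by (rule jordan_dim1[OF linear_left weight_subspaces(2) DNA 2(1) injA])
    have A: "A b = 0" "A a = - D a"
      using A_on_NA A_on_NB ordered_basis_mem[OF a(2)] ordered_basis_mem[OF b(2)] by auto
    have fab: "ordered_basis N [f, a, b]" using weight_basis3[OF f(1) a(2) b(2)] by simp
    then have afb: "ordered_basis N [a, f, b]" by (rule ordered_basis3_swap)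
    have abf: "ordered_basis N [a, b, f]" using fab by (rule ordered_basis3_rotate)
    show ?thesis
    proof (cases "w = 0")
      case True
      from classifiedI[OF _ _ afb w HOL.refl, of "L21 0 (m / l)" "1 / l"] show ?thesis
        using a b A f0 True by (simp add: simps)
    next
      case False
      then have "w = f" using f by simp
      have "ordered_basis N [scale 1 a, scale 1 b, scale ((1 / l)\<^sup>2) f]"
        using a by (intro ordered_basis3_scale[OF abf]) auto
      from classifiedI[OF _ _ this w HOL.refl, of "L25 (m / l)" "1 / l"] show ?thesis
        using a b A f0 \<open>w = f\<close> by (simp add: simps brl.scale brr.scale)
    qed
  next
    case 3
    from jordan_dim2[OF linear_left weight_subspaces(3) DNB 3(2) injB] show ?thesis
    proof cases
      case *: (1 l m e1 e2)
      then have A: "A e1 = 0" "A e2 = 0"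
        using A_on_NB ordered_basis_mem[OF *(3)] by auto
      have "ordered_basis N [f, e1, e2]" using weight_basis3[OF f(1) Nil_bases(2)[OF 3(1)] *(3)] by simp
      then have b: "ordered_basis N [e1, e2, f]" by (rule ordered_basis3_rotate)
      show ?thesis
      proof (cases "w = 0")
        case True
        from classifiedI[OF _ _ b w HOL.refl, of "L23 (m / l) 0" "1 / l"] show ?thesis
          using * A f0 True by (simp add: simps)
      next
        case False
        then have "w = f" using f by simp
        have "ordered_basis N [scale 1 e1, scale 1 e2, scale ((1 / l)\<^sup>2) f]"
          using * by (intro ordered_basis3_scale[OF b]) auto
        from classifiedI[OF _ _ this w HOL.refl, of "L26 (m / l)" "1 / l"] show ?thesis
          using * A f0 \<open>w = f\<close> by (simp add: simps brl.scale brr.scale)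
      qed
    next
      case *: (2 l e1 e2)
      then have A: "A e1 = 0" "A e2 = 0"
        using A_on_NB ordered_basis_mem[OF *(2)] by auto
      have "ordered_basis N [f, e1, e2]" using weight_basis3[OF f(1) Nil_bases(2)[OF 3(1)] *(2)] by simp
      then have b: "ordered_basis N [e1, e2, f]" by (rule ordered_basis3_rotate)
      show ?thesis
      proof (cases "w = 0")
        case True
        from classifiedI[OF _ _ b w HOL.refl, of "L32 0" "1 / l"] show ?thesis
          using * A f0 True by (simp add: simps)
      next
        case False
        then have "w = f" using f by simp
        have "ordered_basis N [scale 1 e1, scale 1 e2, scale ((1 / l)\<^sup>2) f]"
          using * by (intro ordered_basis3_scale[OF b]) auto
        from classifiedI[OF _ _ this w HOL.refl, of "L33" "1 / l"] show ?thesis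
          using * A f0 \<open>w = f\<close> by (simp add: simps brl.scale brr.scale)
      qed
    qed
  qed
qed

text \<open>
  A single eigenvalue \<open>l \<noteq> 0\<close> is left, with eigenvector \<open>a\<close>, and \<open>A a\<close> is \<open>- D a\<close> or \<open>0\<close>; this gives
  two versions of each table. On the plane \<open>N0\<close>, if \<open>D \<noteq> 0\<close> there is a basis \<open>f, D f\<close>. Since \<open>A\<close>
  commutes with \<open>D\<close> and is nilpotent, \<open>A f = \<alpha> D f\<close>, so that \<open>B f = (1 + \<alpha>) D f\<close>. Hence \<open>[x, x]\<close> is
  moved to \<open>0\<close> unless \<open>\<alpha> = -1\<close> or it has a component along \<open>f\<close>; the latter forces \<open>\<alpha> = 0\<close> because \<open>A\<close>
  kills squares. If \<open>D = 0\<close> and \<open>A \<noteq> 0\<close> on \<open>N0\<close>, then the kernel of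
  \<open>B = A\<close> there is its image, so that \<open>[x, x]\<close>, lying in the kernel, is moved to \<open>0\<close>; if both vanish, it is either \<open>0\<close> or a
  basis vector.
\<close>

lemma classified_nil_dim2:
  assumes d0: "dim N0 = 2"
  shows classified
proof -
  note simps = e_nth scale_right_distrib scale_right_diff_distrib brl.scale brr.scale power2_eq_square
  have N0N: "N0 \<subseteq> N" using N01 weight_subspaces subspace_0 unfolding direct_sum_def
    by (smt (verit) add.right_neutral mem_Collect_eq subsetI)
  have d1: "dim NA = 1 \<and> dim NB = 0 \<or> dim NA = 0 \<and> dim NB = 1" using weight_dims AB d0 by linarith
  obtain l a where l: "l \<noteq> 0" and Da: "D a = scale l a" and
    a: "A a = - D a \<or> A a = 0" and
    basis': "\<forall>f g. ordered_basis N0 [f, g] \<longrightarrow> ordered_basis N [f, g, a]"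
    using d1
  proof (elim disjE conjE)
    assume d: "dim NA = 1" "dim NB = 0"
    obtain l a where *: "l \<noteq> 0" "ordered_basis NA [a]" "D a = scale l a"
      by (rule jordan_dim1[OF linear_left weight_subspaces(2) DNA d(1) injA])
    have "ordered_basis N [f, g, a]" if "ordered_basis N0 [f, g]" for f g
      using weight_basis3[OF that *(2) Nil_bases(3)[OF d(2)]] by simp
    then show thesis
      using * A_on_NA ordered_basis_mem[OF *(2)] by (intro that[of l a]) auto
  next
    assume d: "dim NA = 0" "dim NB = 1"
    obtain l a where *: "l \<noteq> 0" "ordered_basis NB [a]" "D a = scale l a"
      by (rule jordan_dim1[OF linear_left weight_subspaces(3) DNB d(2) injB])
    have "ordered_basis N [f, g, a]" if "ordered_basis N0 [f, g]" for f g
      using weight_basis3[OF that Nil_bases(2)[OF d(1)] *(2)] by simp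
    then show thesis
      using * A_on_NB ordered_basis_mem[OF *(2)] by (intro that[of l a]) auto
  qed
  note basis = basis'[rule_format]
  from nilpotent_dim2[OF linear_left weight_subspaces(1) DN0 nilD d0] show ?thesis
  proof cases
    case D0: 1
    from nilpotent_dim2[OF linear_right weight_subspaces(1) AN0 nilA d0] show ?thesis
    proof cases
      case A0: 1
      show ?thesis
      proof (cases "w = 0")
        case True
        obtain es where es: "ordered_basis N0 es" using ordered_basis_exists[OF weight_subspaces(1)] by blast
        moreover have "length es = Suc (Suc 0)" using ordered_basis_dim[OF es] d0 by simp
        ultimately obtain f g where fg: "ordered_basis N0 [f, g]" by (auto simp: length_Suc_conv)
        then have fg0: "D f = 0" "D g = 0" "A f = 0" "A g = 0"
          using D0 A0 ordered_basis_mem by fastforce+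
        have b: "ordered_basis N [a, f, g]" using basis[OF fg] by (rule ordered_basis3_rotate[OF ordered_basis3_rotate])
        from a show ?thesis
        proof
          assume "A a = - D a"
          with classifiedI[OF _ _ b w HOL.refl, of "L20 0 0" "1 / l"] show ?thesis
            using fg0 l Da True by (simp add: simps)
        next
          assume "A a = 0"
          with classifiedI[OF _ _ b w HOL.refl, of "L23 0 0" "1 / l"] show ?thesis
            using fg0 l Da True by (simp add: simps)
        qed
      next
        case False
        have "\<not> N0 \<subseteq> span {w}"
          using dim_le_card[of N0 "{w}"] d0 by auto
        then obtain f where f: "f \<in> N0" "f \<notin> span {w}" by blast
        have i: "independent {f, w}" using f False by (simp add: independent_insert)
        have ne: "f \<noteq> w" using f span_base by auto
        have "N0 \<subseteq> span {f, w}" using card_ge_dim_independent[of "{f, w}" N0] i ne f w0 d0 by auto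
        then have "span {f, w} = N0" using f w0 weight_subspaces(1) by (intro subset_antisym span_minimal) auto
        with i ne have fw: "ordered_basis N0 [f, w]" by (simp add: ordered_basis_def)
        have fg0: "D f = 0" "D w = 0" "A f = 0" "A w = 0" using D0 A0 f w0 by auto
        have "ordered_basis N [a, f, w]" using basis[OF fw] by (rule ordered_basis3_rotate[OF ordered_basis3_rotate])
        then have b: "ordered_basis N [scale 1 a, scale 1 f, scale ((1 / l)\<^sup>2) w]"
          using l by (intro ordered_basis3_scale) auto
        from a show ?thesis
        proof
          assume "A a = - D a"
          with classifiedI[OF _ _ b w HOL.refl, of "L24 0" "1 / l"] show ?thesis
            using fg0 l Da by (simp add: simps)
        next
          assume "A a = 0"
          with classifiedI[OF _ _ b w HOL.refl, of "L26 0" "1 / l"] show ?thesis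
            using fg0 l Da by (simp add: simps)
        qed
      qed
    next
      case (2 f)
      have mem: "f \<in> N0" "A f \<in> N0" using ordered_basis_mem[OF 2(1)] by auto
      have fg0: "D f = 0" "D (A f) = 0" using D0 mem by auto
      obtain s t where st: "w = scale s f + scale t (A f)" by (rule ordered_basis2_coords[OF 2(1) w0])
      have "w + B (scale (- t) f) \<in> squares"
        using w mem N0N by (intro squares_shift subspace_scale[OF N_subspace]) auto
      then have "w + scale (- t) (A f) \<in> squares" using fg0 by (simp add: simps brl.neg brr.neg)
      then have sf: "scale s f \<in> squares" by (simp add: st)
      have Af: "A f \<noteq> 0" using 2(1) dependent_zero by (auto simp: ordered_basis_def)
      have "scale s (A f) = 0" using A_squares[OF sf] by (simp add: brr.scale)
      with Af have "s = 0" by simp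
      with sf have w': "0 \<in> squares" by simp
      have "ordered_basis N [a, f, A f]" using basis[OF 2(1)] by (rule ordered_basis3_rotate[OF ordered_basis3_rotate])
      then have b: "ordered_basis N [scale 1 a, scale 1 f, scale (1 / l) (A f)]"
        using l by (intro ordered_basis3_scale) auto
      from a show ?thesis
      proof
        assume "A a = - D a"
        with classifiedI[OF _ _ b w' HOL.refl, of "L27" "1 / l"] show ?thesis
          using fg0 2 l Da by (simp add: simps)
      next
        assume "A a = 0"
        with classifiedI[OF _ _ b w' HOL.refl, of "L28" "1 / l"] show ?thesis
          using fg0 2 l Da by (simp add: simps)
      qed
    qed
  next
    case (2 f)
    have mem: "f \<in> N0" "D f \<in> N0" "f \<in> N" "A f \<in> N0" using ordered_basis_mem[OF 2(1)] N0N AN0 by auto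
    have Df: "D f \<noteq> 0" using 2(1) dependent_zero by (auto simp: ordered_basis_def)
    obtain c \<alpha> where c\<alpha>: "A f = scale c f + scale \<alpha> (D f)"
      by (rule ordered_basis2_coords[OF 2(1) mem(4)])
    have AD: "A (D f) = scale c (D f)"
      using A_D_commute[OF mem(3)] 2(2) by (simp add: c\<alpha> brl.add brl.scale)
    have "c = 0"
      using nilpotent_no_eigenvalue[OF linear_right weight_subspaces(1) AN0 nilA mem(2) AD] Df by blast
    then have Af: "A f = scale \<alpha> (D f)" "A (D f) = 0" using c\<alpha> AD by auto
    obtain s t where st: "w = scale s f + scale t (D f)" by (rule ordered_basis2_coords[OF 2(1) w0])
    have "scale (s * \<alpha>) (D f) = 0" using A_squares[OF w] st Af by (simp add: brr.add brr.scale)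
    then have s\<alpha>: "s = 0 \<or> \<alpha> = 0" using Df by simp
    have b0: "ordered_basis N [f, D f, a]" by (rule basis[OF 2(1)])
    \<comment> \<open>the square vanishes, or leads the chain of \<open>D\<close>, or ends it\<close>
    consider (zero) "0 \<in> squares" | (first) "s \<noteq> 0" "\<alpha> = 0" | (second) "s = 0" "\<alpha> = -1" "t \<noteq> 0"
    proof (cases "s = 0 \<and> \<alpha> \<noteq> -1")
      case True
      \<comment> \<open>with this factor, \<open>B (r f)\<close> cancels \<open>t D f\<close>\<close>
      let ?r = "- t / (1 + \<alpha>)"
      have "1 + \<alpha> \<noteq> 0" using True by (metis add.commute add_eq_0_iff)
      have "w + B (scale ?r f) \<in> squares"
        using w mem by (intro squares_shift subspace_scale[OF N_subspace]) auto
      moreover have "B (scale ?r f) = scale (?r * (1 + \<alpha>)) (D f)"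
        by (simp only: brl.scale brr.scale Af scale_scale scale_left_distrib ring_distribs)
           (simp add: add.commute)
      moreover have "?r * (1 + \<alpha>) = - t" using \<open>1 + \<alpha> \<noteq> 0\<close> by simp
      ultimately have "0 \<in> squares" using True st by simp
      then show thesis by (rule zero)
    next
      case False
      then show thesis using s\<alpha> w st zero first second by (cases "s = 0"; cases "t = 0") auto
    qed
    then show ?thesis
    proof cases
      case zero
      have b: "ordered_basis N [scale 1 f, scale (1 / l) (D f), scale 1 a]"
        using l by (intro ordered_basis3_scale[OF b0]) auto
      from a show ?thesis
      proof
        assume "A a = - D a"
        with classifiedI[OF _ _ b zero HOL.refl, of "L35 \<alpha>" "1 / l"] show ?thesis
          using Af 2 l Da by (simp add: simps)
      next
        assume "A a = 0"
        with classifiedI[OF _ _ b zero HOL.refl, of "L38 \<alpha>" "1 / l"] show ?thesis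
          using Af 2 l Da by (simp add: simps)
      qed
    next
      case first
      let ?e = "scale ((1 / l)\<^sup>2) w"
      have b: "ordered_basis N [?e, scale (1 / l) (D ?e), scale 1 a]"
      proof (rule ordered_basis3I[OF N_subspace N_dim])
        show "?e \<in> N" "scale (1 / l) (D ?e) \<in> N" "scale 1 a \<in> N"
          using w0 N0N ordered_basis_mem[OF b0] N_right N_subspace by (auto intro!: subspace_scale)
        fix p q r assume "scale p ?e + scale q (scale (1 / l) (D ?e)) + scale r (scale 1 a) = 0"
        then have "scale (p * (1 / l)\<^sup>2 * s) f
            + scale (p * (1 / l)\<^sup>2 * t + q * (1 / l) * (1 / l)\<^sup>2 * s) (D f) + scale r a = 0"
          using 2(2) by (simp add: st brl.add brl.scale scale_left_distrib scale_right_distrib add_ac mult_ac)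
        from ordered_basis3_indep[OF b0 this] show "p = 0 \<and> q = 0 \<and> r = 0"
          using l first by auto
      qed
      have w': "A w = 0" "D (D w) = 0"
        using A_squares[OF w] 2(2) st by (simp_all add: brl.add brl.scale brl.zero)
      have "A (D w) = 0" using Af(2) 2(2) by (simp add: st brl.add brl.scale brr.scale)
      from a show ?thesis
      proof
        assume "A a = - D a"
        with classifiedI[OF _ _ b w HOL.refl, of "L37" "1 / l"] show ?thesis
          using w' \<open>A (D w) = 0\<close> l Da by (simp add: simps)
      next
        assume "A a = 0"
        with classifiedI[OF _ _ b w HOL.refl, of "L40" "1 / l"] show ?thesis
          using w' \<open>A (D w) = 0\<close> l Da by (simp add: simps)
      qed
    next
      case second
      have b: "ordered_basis N [scale (1 / l * t) f, scale ((1 / l)\<^sup>2 * t) (D f), scale 1 a]"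
        using l second by (intro ordered_basis3_scale[OF b0]) auto
      have w': "w = scale t (D f)" using st second by simp
      from a show ?thesis
      proof
        assume "A a = - D a"
        with classifiedI[OF _ _ b w HOL.refl, of "L36" "1 / l"] show ?thesis
          using Af 2 l Da w' second by (simp add: simps)
      next
        assume "A a = 0"
        with classifiedI[OF _ _ b w HOL.refl, of "L39" "1 / l"] show ?thesis
          using Af 2 l Da w' second by (simp add: simps)
      qed
    qed
  qed
qed

lemma classified_weights: classified
proof -
  have "dim N0 = 0 \<or> dim N0 = 1 \<or> dim N0 = 2" using weight_dims AB by linarith
  then show ?thesis
    using classified_invertible classified_nil_dim1 classified_nil_dim2 by blast
qed

end

lemma extension_classified: classified
proof -
  obtain N0 NA NB w where wd:
    "\<exists>N1. direct_sum N N0 N1 \<and> direct_sum N1 NA NB"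
    "D ` N0 \<subseteq> N0" "D ` NA \<subseteq> NA" "D ` NB \<subseteq> NB" "A ` N0 \<subseteq> N0"
    "\<exists>k. \<forall>u\<in>N0. (D ^^ k) u = 0" "\<exists>k. \<forall>u\<in>N0. (A ^^ k) u = 0"
    "\<forall>u\<in>NA. D u = 0 \<longrightarrow> u = 0" "\<forall>u\<in>NB. D u = 0 \<longrightarrow> u = 0"
    "\<forall>u\<in>NA. A u = - D u" "\<forall>u\<in>NB. A u = 0"
    "w \<in> N0" "w \<in> squares" "dim NA + dim NB \<noteq> 0"
    by (rule weight_decomposition)
  then obtain N1 where N1: "direct_sum N N0 N1" "direct_sum N1 NA NB" by blast
  show ?thesis by (rule classified_weights[OF N1 wd(2-)])
qed

end

text \<open>
  The hypotheses of the theorem yield the data of the locale. The vector \<open>[x, x] = c x + n\<close> lies in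
  \<open>N\<close> since \<open>[x, [x, x]] = 0\<close> has \<open>x\<close>-coefficient \<open>c\<^sup>2\<close>. From the second term on, the lower central
  series lies in the images \<open>D\<^sup>j N\<close>; if these were to vanish, the whole algebra would be a nilpotent ideal
  larger than \<open>N\<close>.
\<close>

lemma classification:
  fixes scale :: "complex \<Rightarrow> 'a::ab_group_add \<Rightarrow> 'a"
  assumes L: "leibniz_algebra scale bracket"
    and dim4: "vector_space.dim scale (UNIV :: 'a set) = 4"
    and nilrad: "leibniz_algebra.is_nilradical scale bracket N"
    and dim3: "vector_space.dim scale N = 3"
    and abel: "leibniz_algebra.abelian_set bracket N"
  shows "\<exists>p. admissible p \<and>
    isomorphic_algebras scale bracket (*s) (table_bracket (mult_table p))"
proof -
  interpret L: leibniz_algebra scale bracket by (rule L)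
  obtain Bs where Bs: "L.independent Bs" "UNIV \<subseteq> L.span Bs" "card Bs = L.dim UNIV"
    using L.basis_exists[of UNIV] by metis
  have "finite Bs" using Bs(3) dim4 by (metis card.infinite zero_neq_numeral)
  then interpret V: complex_fd_space scale Bs
    using Bs by unfold_locales auto
  have ideal: "L.two_sided_ideal N" and
    max: "\<And>J. L.two_sided_ideal J \<Longrightarrow> L.nilpotent_set J \<Longrightarrow> N \<subseteq> J \<Longrightarrow> J = N"
    using nilrad by (auto simp: L.is_nilradical_def)
  have N: "L.subspace N" "\<And>n u. n \<in> N \<Longrightarrow> bracket n u \<in> N" "\<And>n u. n \<in> N \<Longrightarrow> bracket u n \<in> N"
    using ideal by (auto simp: L.two_sided_ideal_def)
  have ab: "bracket a b = 0" if "a \<in> N" "b \<in> N" for a b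
    using abel that by (auto simp: L.abelian_set_def)
  have neq: "N \<noteq> UNIV" using dim3 dim4 by auto
  then obtain x where x: "x \<notin> N" by auto
  obtain es where es: "V.ordered_basis N es" using V.ordered_basis_exists[OF N(1)] by blast
  have len: "length es = 3" using V.ordered_basis_dim[OF es] dim3 by simp
  have "distinct (x # es)" "L.independent (set (x # es))"
    using es x L.span_base by (auto simp: V.ordered_basis_def L.independent_insert)
  then have spans: "UNIV \<subseteq> L.span (set (x # es))"
    using V.card_ge_dim_independent[of "set (x # es)" UNIV] len dim4 distinct_card[of "x # es"] by simp
  have dec: "\<exists>a. \<exists>n\<in>N. u = scale a x + n" for u
  proof -
    have "u \<in> L.span (insert x (set es))" using spans by auto
    then obtain k where "u - scale k x \<in> N" using es by (auto simp: L.span_breakdown_eq V.ordered_basis_def)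
    then show ?thesis by (intro exI[of _ k] bexI[of _ "u - scale k x"]) auto
  qed
  interpret brl: Vector_Spaces.linear scale scale "\<lambda>u. bracket u y" for y by (rule L.linear_left)
  interpret brr: Vector_Spaces.linear scale scale "bracket y" for y by (rule L.linear_right)
  have xx: "bracket x x \<in> N"
  proof -
    obtain c n where c: "n \<in> N" "bracket x x = scale c x + n" using dec by blast
    have "bracket x (bracket x x) = 0" using L.leibniz_identity[of x x x] by simp
    then have "scale (c * c) x + (scale c n + bracket x n) = 0"
      unfolding c(2) by (simp add: brr.add brr.scale c(2) L.scale_right_distrib add_ac)
    then have "scale (c * c) x = - (scale c n + bracket x n)"
      by (simp only: eq_neg_iff_add_eq_0)
    also have "\<dots> \<in> N"
      using N c(1) by (intro L.subspace_neg L.subspace_add L.subspace_scale) auto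
    finally have mem: "scale (c * c) x \<in> N" .
    have "c = 0"
    proof (rule ccontr)
      assume "c \<noteq> 0"
      then have "x = scale (1 / (c * c)) (scale (c * c) x)" by simp
      also have "\<dots> \<in> N" by (rule L.subspace_scale[OF N(1) mem])
      finally show False using x by simp
    qed
    with c show ?thesis by simp
  qed
  define D where "D u = bracket u x" for u
  have products: "bracket u v \<in> N" for u v
  proof -
    obtain a m b n where "m \<in> N" "u = scale a x + m" "n \<in> N" "v = scale b x + n" using dec by metis
    then show ?thesis
      using N xx by (simp add: brl.add brl.scale brr.add brr.scale L.subspace_add L.subspace_scale)
  qed
  have lc: "L.lower_central UNIV (Suc j) \<subseteq> (D ^^ j) ` N" for j
  proof (induction j)
    case 0
    have "L.set_bracket UNIV UNIV \<subseteq> N"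
      unfolding L.set_bracket_def using products N(1) by (intro L.span_minimal) auto
    then show ?case by simp
  next
    case (Suc j)
    have lin: "Vector_Spaces.linear scale scale D" unfolding D_def by (rule L.linear_left)
    interpret Dk: Vector_Spaces.linear scale scale "D ^^ Suc j" by (rule V.funpow_linear[OF lin])
    have sub: "L.subspace ((D ^^ Suc j) ` N)" by (rule Dk.subspace_image[OF N(1)])
    have DN: "(D ^^ j) ` N \<subseteq> N" using N(2) by (intro V.funpow_invariant) (auto simp: D_def)
    have "bracket a b \<in> (D ^^ Suc j) ` N" if "a \<in> L.lower_central UNIV (Suc j)" for a b
    proof -
      have a: "a \<in> (D ^^ j) ` N" using that Suc by blast
      obtain c n where b: "n \<in> N" "b = scale c x + n" using dec by blast
      have "bracket a b = scale c (D a)"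
        using a DN b ab by (auto simp: brr.add brr.scale D_def)
      moreover have "D a \<in> (D ^^ Suc j) ` N" using a by auto
      ultimately show ?thesis using L.subspace_scale[OF sub] by simp
    qed
    then have "L.set_bracket (L.lower_central UNIV (Suc j)) UNIV \<subseteq> (D ^^ Suc j) ` N"
      unfolding L.set_bracket_def using sub by (intro L.span_minimal) blast+
    then show ?case by simp
  qed
  have nonnil: "\<exists>n\<in>N. (D ^^ k) n \<noteq> 0" for k
  proof (rule ccontr)
    assume "\<not> ?thesis"
    then have "L.lower_central UNIV (Suc k) \<subseteq> {0}" using lc[of k] by auto
    moreover have "0 \<in> L.lower_central UNIV (Suc k)" by (simp add: L.set_bracket_def L.span_zero)
    ultimately have "L.nilpotent_set UNIV" unfolding L.nilpotent_set_def by blast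
    moreover have "L.two_sided_ideal UNIV" by (simp add: L.two_sided_ideal_def)
    ultimately show False using max neq by blast
  qed
  interpret E: leibniz_extension scale Bs bracket N x
    using N dim3 x dec ab xx nonnil unfolding D_def by unfold_locales blast+
  show ?thesis using E.extension_classified unfolding E.classified_def .
qed

section \<open>Invariants of the tables\<close>

lemma isomorphic_algebras_sym:
  assumes "isomorphic_algebras s1 b1 s2 b2"
  shows "isomorphic_algebras s2 b2 s1 b1"
proof -
  obtain f where f: "Vector_Spaces.linear s1 s2 f" "bij f" "\<And>u v. f (b1 u v) = b2 (f u) (f v)"
    using assms by (auto simp: isomorphic_algebras_def)
  interpret f: Vector_Spaces.linear s1 s2 f by (rule f)
  have fi: "f (inv f u) = u" "inv f (f v) = v" for u v
    using f(2) by (simp_all add: bij_is_surj surj_f_inv_f bij_is_inj)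
  have "inv f (a + b) = inv f a + inv f b" "inv f (s2 r b) = s1 r (inv f b)" for a b r
    by (metis fi f.add, metis fi f.scale)
  then have "Vector_Spaces.linear s2 s1 (inv f)"
    by (intro Vector_Spaces.linear_iff[THEN iffD2])
       (simp add: f.vs1.vector_space_axioms f.vs2.vector_space_axioms)
  moreover have "inv f (b2 u v) = b1 (inv f u) (inv f v)" for u v
    by (metis fi f(3))
  ultimately show ?thesis
    using bij_imp_bij_inv[OF f(2)] unfolding isomorphic_algebras_def by blast
qed

abbreviation tab :: "alg \<Rightarrow> complex ^ gen \<Rightarrow> complex ^ gen \<Rightarrow> complex ^ gen" where
  "tab p \<equiv> table_bracket (mult_table p)"

text \<open>
  The projection onto the span of \<open>e1, e2, e3\<close> along \<open>x\<close>. Composing with it turns the operators of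
  the nilradical into operators of the whole space that vanish at \<open>x\<close>, so that no subspace has to
  be mentioned below.
\<close>

definition radical_part :: "complex ^ gen \<Rightarrow> complex ^ gen" where
  "radical_part u = u - (u $ X) *s e X"

definition right_op :: "alg \<Rightarrow> complex ^ gen \<Rightarrow> complex ^ gen" where
  "right_op p u = tab p (radical_part u) (e X)"

definition left_op :: "alg \<Rightarrow> complex ^ gen \<Rightarrow> complex ^ gen" where
  "left_op p u = tab p (e X) (radical_part u)"

definition sum_op :: "alg \<Rightarrow> complex ^ gen \<Rightarrow> complex ^ gen" where
  "sum_op p u = left_op p u + right_op p u"

lemma radical_part_nth: "radical_part u $ k = (if k = X then 0 else u $ k)"
  by (simp add: radical_part_def e_nth)

lemma right_op_nth: "right_op p u $ k = u $ E1 * mult_table p (E1, X) $ k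
    + u $ E2 * mult_table p (E2, X) $ k + u $ E3 * mult_table p (E3, X) $ k"
  by (simp add: right_op_def table_bracket_nth radical_part_nth e_nth)

lemma left_op_nth: "left_op p u $ k = u $ E1 * mult_table p (X, E1) $ k
    + u $ E2 * mult_table p (X, E2) $ k + u $ E3 * mult_table p (X, E3) $ k"
  by (simp add: left_op_def table_bracket_nth radical_part_nth e_nth)

lemma sum_op_nth: "sum_op p u $ k = left_op p u $ k + right_op p u $ k"
  by (simp add: sum_op_def)

lemma linear_ops:
  "Vector_Spaces.linear (*s) (*s) (right_op p)"
  "Vector_Spaces.linear (*s) (*s) (left_op p)"
  "Vector_Spaces.linear (*s) (*s) (sum_op p)"
  by (auto intro!: Vector_Spaces.linear_iff[THEN iffD2]
      simp: vec.vector_space_axioms vec_eq_iff right_op_nth left_op_nth sum_op_nth algebra_simps)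

lemma tab_nth_X: "tab p u v $ X = 0"
  by (simp add: table_bracket_nth mult_table_in_radical)

lemma tab_radical_radical: "u $ X = 0 \<Longrightarrow> v $ X = 0 \<Longrightarrow> tab p u v = 0"
  by (simp add: vec_eq_iff table_bracket_nth mult_table_radical_abelian)

lemma radical_part_id: "u $ X = 0 \<Longrightarrow> radical_part u = u"
  by (simp add: radical_part_def)

lemma radical_part_split: "u = (u $ X) *s e X + radical_part u"
  by (simp add: radical_part_def)

lemma tab_radical_left: "w $ X = 0 \<Longrightarrow> tab p w u = (u $ X) *s right_op p w"
  by (simp add: vec_eq_iff table_bracket_nth right_op_nth mult_table_radical_abelian algebra_simps)

text \<open>
  If \<open>u\<close> has \<open>x\<close>-coefficient \<open>s\<close>, the square of right multiplication by \<open>u\<close> acts on \<open>e1, e2, e3\<close> as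
  \<open>s\<^sup>2 D\<^sup>2\<close>. In every table \<open>D\<close> has a diagonal entry \<open>1\<close> at \<open>e1\<close> or at \<open>e3\<close>.
\<close>

lemma nilradical_characterization:
  "(\<forall>w. tab p (tab p w u) u = 0) \<longleftrightarrow> u $ X = 0"
proof
  assume *: "\<forall>w. tab p (tab p w u) u = 0"
  have "(u $ X * u $ X) * right_op p (right_op p (e i)) $ i = 0" if "i \<noteq> X" for i
  proof -
    have "tab p (tab p (e i) u) u $ i = 0" using * by simp
    moreover have "tab p (tab p (e i) u) u = (u $ X * u $ X) *s right_op p (right_op p (e i))"
      using that by (simp add: tab_radical_left e_nth right_op_nth mult_table_in_radical
          vec_eq_iff algebra_simps)
    ultimately show ?thesis by simp
  qed
  from this[of E1] this[of E3] show "u $ X = 0"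
    by (cases p) (simp_all add: right_op_nth e_nth)
next
  assume "u $ X = 0"
  then show "\<forall>w. tab p (tab p w u) u = 0"
    by (simp add: tab_radical_radical tab_nth_X)
qed

text \<open>
  An isomorphism \<open>f\<close> preserves the nilradical, hence \<open>f x = a x + n\<close> with \<open>a \<noteq> 0\<close> and \<open>n\<close> in the
  nilradical. The map \<open>g\<close> agrees with \<open>f\<close> on the nilradical and fixes \<open>x\<close>, so that it also
  intertwines the extensions by zero of the operators.
\<close>

lemma isomorphism_intertwines:
  assumes "isomorphic_algebras (*s) (tab p) (*s) (tab q)"
  obtains a g n where "a \<noteq> 0" "Vector_Spaces.linear (*s) (*s) g" "bij g"
    "\<And>u. g (right_op p u) = a *s right_op q (g u)" "\<And>u. g (left_op p u) = a *s left_op q (g u)"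
    "g (mult_table p (X, X)) = a\<^sup>2 *s mult_table q (X, X) + a *s sum_op q n"
proof -
  obtain f where f: "Vector_Spaces.linear (*s) (*s) f" "bij f" "\<And>u v. f (tab p u v) = tab q (f u) (f v)"
    using assms by (auto simp: isomorphic_algebras_def)
  interpret f: Vector_Spaces.linear "(*s)" "(*s)" f by (rule f)
  interpret q: leibniz_algebra "(*s)" "tab q" by (rule leibniz_table)
  interpret ql: Vector_Spaces.linear "(*s)" "(*s)" "\<lambda>u. tab q u y" for y by (rule q.linear_left)
  interpret qr: Vector_Spaces.linear "(*s)" "(*s)" "tab q y" for y by (rule q.linear_right)
  have X: "f u $ X = 0 \<longleftrightarrow> u $ X = 0" for u
  proof -
    have "f u $ X = 0 \<longleftrightarrow> (\<forall>w. tab q (tab q w (f u)) (f u) = 0)"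
      by (simp only: nilradical_characterization)
    also have "\<dots> \<longleftrightarrow> (\<forall>w. tab q (tab q (f w) (f u)) (f u) = 0)"
      using bij_is_surj[OF f(2)] by (metis surjD)
    also have "\<dots> \<longleftrightarrow> (\<forall>w. f (tab p (tab p w u) u) = f 0)"
      by (simp only: f(3) f.zero)
    also have "\<dots> \<longleftrightarrow> (\<forall>w. tab p (tab p w u) u = 0)"
      using bij_is_inj[OF f(2)] by (simp only: inj_eq)
    finally show ?thesis by (simp only: nilradical_characterization)
  qed
  define a where "a = f (e X) $ X"
  define n where "n = radical_part (f (e X))"
  have fX: "f (e X) = a *s e X + n" and nX: "n $ X = 0"
    using radical_part_split[of "f (e X)"] by (simp_all add: a_def n_def radical_part_nth)
  have a: "a \<noteq> 0" using X[of "e X"] by (simp add: a_def e_nth)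
  have rX: "f (radical_part u) $ X = 0" for u by (simp add: X radical_part_nth)
  define g where "g u = f (radical_part u) + (u $ X) *s e X" for u
  have radadd: "radical_part (u + v) = radical_part u + radical_part v" "radical_part (c *s u) = c *s radical_part u" for u v c
    by (simp_all add: vec_eq_iff radical_part_nth)
  have g: "Vector_Spaces.linear (*s) (*s) g"
    by (rule Vector_Spaces.linear_iff[THEN iffD2])
       (simp add: vec.vector_space_axioms g_def radadd f.add f.scale vec_eq_iff algebra_simps)
  interpret g: Vector_Spaces.linear "(*s)" "(*s)" g by (rule g)
  have "inj g"
    unfolding g.inj_iff_eq_0
  proof (intro allI impI)
    fix u assume u: "g u = 0"
    then have "g u $ X = 0" by simp
    then have uX: "u $ X = 0" by (simp add: g_def rX e_nth)
    with u have "f u = f 0" by (simp add: g_def radical_part_id f.zero)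
    then show "u = 0" using bij_is_inj[OF f(2)] by (simp only: inj_eq)
  qed
  then have "bij g" using vec.linear_inj_imp_surj[OF g] by (simp add: bij_def)
  have gN: "g u = f u" if "u $ X = 0" for u using that by (simp add: g_def radical_part_id)
  have radg: "radical_part (g u) = f (radical_part u)" for u
    using rX by (simp add: vec_eq_iff radical_part_nth g_def e_nth)
  have 1: "g (right_op p u) = a *s right_op q (g u)" for u
  proof -
    have "g (right_op p u) = tab q (f (radical_part u)) (f (e X))"
      by (simp add: right_op_def gN tab_nth_X f(3))
    also have "\<dots> = a *s tab q (f (radical_part u)) (e X)"
      by (simp add: fX qr.add qr.scale tab_radical_radical rX nX)
    finally show ?thesis by (simp add: right_op_def radg)
  qed
  have 2: "g (left_op p u) = a *s left_op q (g u)" for u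
  proof -
    have "g (left_op p u) = tab q (f (e X)) (f (radical_part u))"
      by (simp add: left_op_def gN tab_nth_X f(3))
    also have "\<dots> = a *s tab q (e X) (f (radical_part u))"
      by (simp add: fX ql.add ql.scale tab_radical_radical rX nX)
    finally show ?thesis by (simp add: left_op_def radg)
  qed
  have XX: "mult_table r (X, X) = tab r (e X) (e X)" for r
    by (simp add: vec_eq_iff table_bracket_nth e_nth)
  have "g (mult_table p (X, X)) = tab q (f (e X)) (f (e X))"
    by (simp add: XX gN tab_nth_X f(3))
  also have "\<dots> = a\<^sup>2 *s tab q (e X) (e X) + a *s (tab q (e X) n + tab q n (e X))"
    by (simp add: fX ql.add ql.scale qr.add qr.scale tab_radical_radical nX power2_eq_square
        vec.scale_right_distrib)
  also have "tab q (e X) n + tab q n (e X) = sum_op q n"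
    by (simp add: sum_op_def left_op_def right_op_def radical_part_id nX)
  finally have "g (mult_table p (X, X)) = a\<^sup>2 *s mult_table q (X, X) + a *s sum_op q n"
    by (simp only: XX)
  then show ?thesis by (rule that[OF a g \<open>bij g\<close> 1 2])
qed

definition op_trace :: "(complex ^ gen \<Rightarrow> complex ^ gen) \<Rightarrow> complex" where
  "op_trace U = (\<Sum>i\<in>UNIV. U (e i) $ i)"

lemma vec_expand: "u = (\<Sum>i\<in>UNIV. (u $ i) *s e i)"
  by (simp add: vec_eq_iff sum_gen e_nth all_gen)

lemma op_trace_commute:
  assumes U: "Vector_Spaces.linear (*s) (*s) U" and V: "Vector_Spaces.linear (*s) (*s) V"
  shows "op_trace (\<lambda>u. U (V u)) = op_trace (\<lambda>u. V (U u))"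
proof -
  have exp: "U' (V' (e j)) $ j = (\<Sum>i\<in>UNIV. V' (e j) $ i * U' (e i) $ j)"
    if "Vector_Spaces.linear (*s) (*s) U'" for U' V' j
  proof -
    interpret U: Vector_Spaces.linear "(*s)" "(*s)" U' by (rule that)
    have "U' (V' (e j)) = (\<Sum>i\<in>UNIV. (V' (e j) $ i) *s U' (e i))"
      by (subst vec_expand) (simp add: U.sum U.scale)
    then show ?thesis by simp
  qed
  show ?thesis
    unfolding op_trace_def exp[OF U] exp[OF V] by (subst sum.swap) (simp add: mult.commute)
qed

lemma op_trace_conjugate:
  assumes U: "Vector_Spaces.linear (*s) (*s) U" and g: "Vector_Spaces.linear (*s) (*s) g" "bij g"
    and UV: "\<And>u. g (U u) = V (g u)"
  shows "op_trace U = op_trace V"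
proof -
  obtain h where h: "Vector_Spaces.linear (*s) (*s) h" "h \<circ> g = id"
    using vec.linear_injective_left_inverse[OF g(1) bij_is_inj[OF g(2)]] by blast
  then have hg: "h (g u) = u" for u by (metis comp_apply id_apply)
  have gh: "g (h u) = u" for u
    using hg bij_is_surj[OF g(2)] by (metis surj_def)
  have "op_trace U = op_trace (\<lambda>u. U (h (g u)))" by (simp add: hg)
  also have "\<dots> = op_trace (\<lambda>u. g (U (h u)))"
    using op_trace_commute[OF Vector_Spaces.linear_compose[OF h(1) U] g(1)] by (simp add: o_def)
  also have "\<dots> = op_trace V" by (simp add: UV gh)
  finally show ?thesis .
qed

lemma linear_funpow_vec:
  "Vector_Spaces.linear (*s) (*s) U \<Longrightarrow> Vector_Spaces.linear (*s) (*s) (U ^^ k)" for U :: "complex ^ gen \<Rightarrow> complex ^ gen"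
proof (induction k)
  case 0
  have "U ^^ 0 = (\<lambda>x. x)" by auto
  then show ?case using vec.linear_id by simp
next
  case (Suc k)
  then show ?case using Vector_Spaces.linear_compose[OF Suc.IH[OF Suc.prems] Suc.prems] by (simp add: o_def)
qed

text \<open>
  If \<open>U\<close> is conjugate to \<open>a V\<close>, the traces of their powers agree.
\<close>

lemma op_trace_power:
  assumes U: "Vector_Spaces.linear (*s) (*s) U" and V: "Vector_Spaces.linear (*s) (*s) V"
    and g: "Vector_Spaces.linear (*s) (*s) g" "bij g"
    and UV: "\<And>u. g (U u) = a *s V (g u)"
  shows "op_trace (U ^^ k) = a ^ k * op_trace (V ^^ k)"
proof -
  interpret V: Vector_Spaces.linear "(*s)" "(*s)" V by (rule V)
  have "g ((U ^^ k) u) = a ^ k *s (V ^^ k) (g u)" for u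
    by (induction k) (simp_all add: UV V.scale mult.commute)
  then have "op_trace (U ^^ k) = op_trace (\<lambda>u. a ^ k *s (V ^^ k) u)"
    by (intro op_trace_conjugate[OF linear_funpow_vec[OF U] g])
  then show ?thesis by (simp add: op_trace_def sum_distrib_left)
qed

text \<open>
  By Newton's identities the power sums determine the elementary symmetric functions, so \<open>x\<close> is a root
  of the polynomial with roots \<open>x', y', z'\<close>; cancel it and repeat with two numbers.
\<close>

lemma power_sums_determine_mset3:
  fixes x y z x' y' z' :: complex
  assumes 1: "x + y + z = x' + y' + z'" and 2: "x^2 + y^2 + z^2 = x'^2 + y'^2 + z'^2"
    and 3: "x^3 + y^3 + z^3 = x'^3 + y'^3 + z'^3"
  shows "{#x, y, z#} = {#x', y', z'#}"
proof -
  have two: "{#b, c#} = {#b', c'#}"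
    if "b + c = b' + c'" "b^2 + c^2 = b'^2 + c'^2" for b c b' c' :: complex
  proof -
    have "2 * ((b - b') * (b - c')) = 0" using that by algebra
    then have "b = b' \<or> b = c'" by auto
    with that show ?thesis by auto
  qed
  have "6 * ((x - x') * (x - y') * (x - z')) = 0" using 1 2 3 by algebra
  then consider "x = x'" | "x = y'" | "x = z'" by auto
  then show ?thesis
  proof cases
    case 1 with assms two[of y z y' z'] show ?thesis by simp
  next
    case 2 with assms two[of y z x' z'] show ?thesis by (simp add: add_mset_commute add_ac)
  next
    case 3 with assms two[of y z x' y'] show ?thesis by (simp add: add_mset_commute add_ac)
  qed
qed

text \<open>
  The eigenvalues on the nilradical when \<open>U\<close> is triangular in the basis \<open>e1, e2, e3\<close>, as the left
  operators and the sum operators of all tables are.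
\<close>

definition diag_mset :: "(complex ^ gen \<Rightarrow> complex ^ gen) \<Rightarrow> complex multiset" where
  "diag_mset U = {#U (e E1) $ E1, U (e E2) $ E2, U (e E3) $ E3#}"

lemma op_trace_triangular:
  assumes U: "\<And>u k. U u $ k = u $ E1 * m E1 k + u $ E2 * m E2 k + u $ E3 * m E3 k"
    and m: "m E2 E1 = 0" "m E3 E1 = 0" "m E3 E2 = 0" "\<And>i. m i X = 0"
    and k: "k = 1 \<or> k = 2 \<or> k = 3"
  shows "op_trace (U ^^ k) = (U (e E1) $ E1) ^ k + (U (e E2) $ E2) ^ k + (U (e E3) $ E3) ^ k"
  using k by (elim disjE; simp add: op_trace_def sum_gen U m e_nth numeral_eq_Suc)

lemma op_trace_powers:
  assumes "U = left_op p \<or> U = sum_op p" "k = 1 \<or> k = 2 \<or> k = 3"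
  shows "op_trace (U ^^ k) = (U (e E1) $ E1) ^ k + (U (e E2) $ E2) ^ k + (U (e E3) $ E3) ^ k"
  using assms(1)
proof
  assume U: "U = left_op p"
  show ?thesis
    unfolding U
  proof (rule op_trace_triangular[OF left_op_nth _ _ _ mult_table_in_radical assms(2)])
    show "mult_table p (X, E2) $ E1 = 0" "mult_table p (X, E3) $ E1 = 0" "mult_table p (X, E3) $ E2 = 0"
      by (cases p; simp add: e_nth)+
  qed
next
  assume U: "U = sum_op p"
  let ?m = "\<lambda>i k. mult_table p (X, i) $ k + mult_table p (i, X) $ k"
  show ?thesis
    unfolding U
  proof (rule op_trace_triangular[where m = ?m, OF _ _ _ _ _ assms(2)])
    show "sum_op p u $ k = u $ E1 * ?m E1 k + u $ E2 * ?m E2 k + u $ E3 * ?m E3 k" for u k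
      by (simp add: sum_op_nth left_op_nth right_op_nth algebra_simps)
    show "?m E2 E1 = 0" "?m E3 E1 = 0" "?m E3 E2 = 0"
      by (cases p; simp add: e_nth)+
    show "?m i X = 0" for i by (simp add: mult_table_in_radical)
  qed
qed

lemma diag_mset_scaled:
  assumes "U = left_op p \<and> V = left_op q \<or> U = sum_op p \<and> V = sum_op q"
    and g: "Vector_Spaces.linear (*s) (*s) g" "bij g"
    and UV: "\<And>u. g (U u) = a *s V (g u)"
  shows "diag_mset U = image_mset ((*) a) (diag_mset V)"
proof -
  have lin: "Vector_Spaces.linear (*s) (*s) U" "Vector_Spaces.linear (*s) (*s) V"
    using assms(1) linear_ops by auto
  have k: "op_trace (U ^^ k) = a ^ k * op_trace (V ^^ k)" for k
    by (rule op_trace_power[OF lin g UV])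
  let ?d = "\<lambda>W i. W (e i) $ i"
  have s: "?d U E1 ^ k + ?d U E2 ^ k + ?d U E3 ^ k =
      (a * ?d V E1) ^ k + (a * ?d V E2) ^ k + (a * ?d V E3) ^ k" if "k = 1 \<or> k = 2 \<or> k = 3" for k
  proof -
    have "U = left_op p \<or> U = sum_op p" "V = left_op q \<or> V = sum_op q" using assms(1) by auto
    then show ?thesis
      using k[of k] op_trace_powers[OF _ that] by (simp add: power_mult_distrib algebra_simps)
  qed
  show ?thesis
    unfolding diag_mset_def
    using power_sums_determine_mset3[of "?d U E1" "?d U E2" "?d U E3" "a * ?d V E1" "a * ?d V E2" "a * ?d V E3"]
      s[of 1] s[of 2] s[of 3] by simp
qed

definition shift_op :: "(complex ^ gen \<Rightarrow> complex ^ gen) \<Rightarrow> complex \<Rightarrow> complex ^ gen \<Rightarrow> complex ^ gen" where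
  "shift_op U s w = U w - s *s w"

text \<open>
  For some eigenvalue \<open>s\<close> there is a Jordan block of size at least two.
\<close>

definition has_jordan_block :: "(complex ^ gen \<Rightarrow> complex ^ gen) \<Rightarrow> bool" where
  "has_jordan_block U \<longleftrightarrow> (\<exists>s w. shift_op U s (shift_op U s w) = 0 \<and> shift_op U s w \<noteq> 0)"

text \<open>
  The factors between \<open>A w\<close> and \<open>D w\<close> at the head of a Jordan chain \<open>w, D w\<close> for the eigenvalue \<open>0\<close>.
  They do not change when \<open>x\<close> is rescaled and show the parameter of \<open>L35\<close> and \<open>L38\<close>.
\<close>

definition ratios :: "alg \<Rightarrow> complex set" where
  "ratios p = {\<alpha>. \<exists>w. right_op p (right_op p w) = 0 \<and> right_op p w \<noteq> 0 \<and> left_op p w = \<alpha> *s right_op p w}"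

text \<open>
  The square \<open>[x, x]\<close> becomes zero after adding an element of the nilradical to \<open>x\<close>.
\<close>

definition square_removable :: "alg \<Rightarrow> bool" where
  "square_removable p \<longleftrightarrow> (\<exists>n. mult_table p (X, X) = sum_op p n)"

text \<open>
  Right multiplication by \<open>x\<close>, extended by zero, is annihilated by \<open>X (X - s)\<^sup>2\<close>. The factor \<open>X\<close> accounts for \<open>x\<close>, at which the operator
  vanishes. This separates one Jordan block of size three from smaller blocks with the same single
  eigenvalue.
\<close>

definition double_root_annihilates :: "alg \<Rightarrow> bool" where
  "double_root_annihilates p \<longleftrightarrow> (\<exists>s. \<forall>w. right_op p (shift_op (right_op p) s (shift_op (right_op p) s w)) = 0)"

lemma shift_op_nth: "shift_op U s w $ k = U w $ k - s * w $ k"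
  by (simp add: shift_op_def)

context
  fixes g :: "complex ^ gen \<Rightarrow> complex ^ gen" and a p q n
  assumes a: "a \<noteq> 0" and g: "Vector_Spaces.linear (*s) (*s) g" "bij g"
    and gR: "\<And>u. g (right_op p u) = a *s right_op q (g u)" and gL: "\<And>u. g (left_op p u) = a *s left_op q (g u)"
    and gX: "g (mult_table p (X, X)) = a\<^sup>2 *s mult_table q (X, X) + a *s sum_op q n"
begin

interpretation g: Vector_Spaces.linear "(*s)" "(*s)" g by (rule g)

lemma intertwiner_eq_0_iff: "g u = 0 \<longleftrightarrow> u = 0"
  using bij_is_inj[OF g(2)] g.zero by (metis injD)

lemma shift_op_conj:
  assumes "\<And>u. g (U u) = a *s V (g u)"
  shows "g (shift_op U s w) = a *s shift_op V (s / a) (g w)"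
  using a by (simp add: shift_op_def g.diff g.scale assms vec.scale_right_diff_distrib)

lemma has_jordan_block_conj:
  assumes "\<And>u. g (U u) = a *s V (g u)" and V: "Vector_Spaces.linear (*s) (*s) V" and "has_jordan_block U"
  shows "has_jordan_block V"
proof -
  interpret V: Vector_Spaces.linear "(*s)" "(*s)" V by (rule V)
  have sc: "shift_op V s (a *s w) = a *s shift_op V s w" for s w
    by (simp add: shift_op_def V.scale vec.scale_right_diff_distrib mult.commute)
  obtain s w where sw: "shift_op U s (shift_op U s w) = 0" "shift_op U s w \<noteq> 0"
    using assms(3) by (auto simp: has_jordan_block_def)
  have "g (shift_op U s (shift_op U s w)) = a *s (a *s shift_op V (s / a) (shift_op V (s / a) (g w)))"
    by (simp only: shift_op_conj[of U V, OF assms(1)] sc)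
  moreover have "g (shift_op U s w) = a *s shift_op V (s / a) (g w)"
    by (rule shift_op_conj[of U V, OF assms(1)])
  ultimately have "shift_op V (s / a) (shift_op V (s / a) (g w)) = 0" "shift_op V (s / a) (g w) \<noteq> 0"
    using sw intertwiner_eq_0_iff[of "shift_op U s w"] a by (auto simp: g.zero)
  then show ?thesis unfolding has_jordan_block_def by blast
qed

lemma ops_scale: "right_op q (c *s u) = c *s right_op q u" "left_op q (c *s u) = c *s left_op q u"
  by (simp_all add: vec_eq_iff right_op_nth left_op_nth algebra_simps)

lemma ratios_conj: "ratios p \<subseteq> ratios q"
proof
  fix \<alpha> assume "\<alpha> \<in> ratios p"
  then obtain w where w: "right_op p (right_op p w) = 0" "right_op p w \<noteq> 0" "left_op p w = \<alpha> *s right_op p w"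
    by (auto simp: ratios_def)
  have "g (right_op p (right_op p w)) = a *s (a *s right_op q (right_op q (g w)))"
    by (simp only: gR ops_scale)
  moreover have "g (right_op p w) = a *s right_op q (g w)" by (rule gR)
  moreover have "a *s left_op q (g w) = a *s (\<alpha> *s right_op q (g w))"
    using w(3) by (metis g.scale gL gR vec.scale_left_commute)
  then have "left_op q (g w) = \<alpha> *s right_op q (g w)"
    using a by (rule vec.scale_left_imp_eq[rotated])
  ultimately have "right_op q (right_op q (g w)) = 0" "right_op q (g w) \<noteq> 0" "left_op q (g w) = \<alpha> *s right_op q (g w)"
    using w intertwiner_eq_0_iff[of "right_op p w"] a by (auto simp: g.zero)
  then show "\<alpha> \<in> ratios q" unfolding ratios_def by blast
qed

lemma square_removable_conj: "square_removable p \<Longrightarrow> square_removable q"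
proof -
  assume "square_removable p"
  then obtain m where m: "mult_table p (X, X) = sum_op p m" by (auto simp: square_removable_def)
  have "g (sum_op p m) = a *s sum_op q (g m)" by (simp add: sum_op_def g.add gL gR vec.scale_right_distrib)
  then have "a\<^sup>2 *s mult_table q (X, X) = a *s (sum_op q (g m) - sum_op q n)"
    using gX m by (simp add: vec.scale_right_diff_distrib algebra_simps)
  then have "(1 / a\<^sup>2) *s (a\<^sup>2 *s mult_table q (X, X)) = (1 / a\<^sup>2) *s (a *s (sum_op q (g m) - sum_op q n))" by simp
  then have "mult_table q (X, X) = (1 / a) *s (sum_op q (g m) - sum_op q n)"
    using a by (simp add: power2_eq_square)
  also have "\<dots> = sum_op q ((1 / a) *s (g m - n))"
    by (simp add: vec_eq_iff sum_op_nth right_op_nth left_op_nth algebra_simps diff_divide_distrib add_divide_distrib)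
  finally show ?thesis unfolding square_removable_def by blast
qed

lemma double_root_annihilates_conj: "double_root_annihilates p \<Longrightarrow> double_root_annihilates q"
proof -
  assume "double_root_annihilates p"
  then obtain s where s: "\<And>w. right_op p (shift_op (right_op p) s (shift_op (right_op p) s w)) = 0"
    by (auto simp: double_root_annihilates_def)
  have sc: "shift_op (right_op q) s (a *s w) = a *s shift_op (right_op q) s w" for s w
    by (simp add: shift_op_def ops_scale vec.scale_right_diff_distrib mult.commute)
  have "right_op q (shift_op (right_op q) (s / a) (shift_op (right_op q) (s / a) u)) = 0" for u
  proof -
    obtain w where u: "u = g w" using bij_is_surj[OF g(2)] by (metis surjD)
    have "g (right_op p (shift_op (right_op p) s (shift_op (right_op p) s w))) =
        a *s (a *s (a *s right_op q (shift_op (right_op q) (s / a) (shift_op (right_op q) (s / a) (g w)))))"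
      by (simp only: gR ops_scale shift_op_conj[of "right_op p" "right_op q", OF gR] sc)
    then show ?thesis using s[of w] a by (simp add: u g.zero)
  qed
  then show ?thesis unfolding double_root_annihilates_def by blast
qed

end

text \<open>
  Every invariant is preserved in one direction by an intertwining map; the inverse isomorphism
  gives the other direction.
\<close>

lemma isomorphic_invariants_mono:
  assumes "isomorphic_algebras (*s) (tab p) (*s) (tab q)"
  shows "\<exists>a. a \<noteq> 0 \<and> diag_mset (left_op p) = image_mset ((*) a) (diag_mset (left_op q)) \<and>
      diag_mset (sum_op p) = image_mset ((*) a) (diag_mset (sum_op q))"
    and "ratios p \<subseteq> ratios q"
    and "has_jordan_block (left_op p) \<Longrightarrow> has_jordan_block (left_op q)" "has_jordan_block (right_op p) \<Longrightarrow> has_jordan_block (right_op q)"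
    and "square_removable p \<Longrightarrow> square_removable q" "double_root_annihilates p \<Longrightarrow> double_root_annihilates q"
proof -
  obtain a g n where *: "a \<noteq> 0" "Vector_Spaces.linear (*s) (*s) g" "bij g"
    "\<And>u. g (right_op p u) = a *s right_op q (g u)" "\<And>u. g (left_op p u) = a *s left_op q (g u)"
    "g (mult_table p (X, X)) = a\<^sup>2 *s mult_table q (X, X) + a *s sum_op q n"
    by (rule isomorphism_intertwines[OF assms]) blast
  interpret g: Vector_Spaces.linear "(*s)" "(*s)" g by (rule *)
  have B: "g (sum_op p u) = a *s sum_op q (g u)" for u
    by (simp add: sum_op_def g.add *(4,5) vec.scale_right_distrib)
  show "\<exists>a. a \<noteq> 0 \<and> diag_mset (left_op p) = image_mset ((*) a) (diag_mset (left_op q)) \<and>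
      diag_mset (sum_op p) = image_mset ((*) a) (diag_mset (sum_op q))"
    using *(1) diag_mset_scaled[of "left_op p" p "left_op q" q g a, OF _ *(2,3,5)]
      diag_mset_scaled[of "sum_op p" p "sum_op q" q g a, OF _ *(2,3) B] by blast
  show "ratios p \<subseteq> ratios q" by (rule ratios_conj[OF *])
  show "has_jordan_block (left_op p) \<Longrightarrow> has_jordan_block (left_op q)"
    by (rule has_jordan_block_conj[OF * *(5) linear_ops(2)])
  show "has_jordan_block (right_op p) \<Longrightarrow> has_jordan_block (right_op q)"
    by (rule has_jordan_block_conj[OF * *(4) linear_ops(1)])
  show "square_removable p \<Longrightarrow> square_removable q" by (rule square_removable_conj[OF *])
  show "double_root_annihilates p \<Longrightarrow> double_root_annihilates q" by (rule double_root_annihilates_conj[OF *])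
qed
lemma ratios_eq:
  "ratios p = (case p of L35 \<alpha> \<Rightarrow> {\<alpha>} | L36 \<Rightarrow> {-1} | L37 \<Rightarrow> {0}
     | L38 \<alpha> \<Rightarrow> {\<alpha>} | L39 \<Rightarrow> {-1} | L40 \<Rightarrow> {0} | _ \<Rightarrow> {})"
proof -
  have e1: "\<alpha> \<in> ratios p" if "right_op p (right_op p (e E1)) = 0" "right_op p (e E1) \<noteq> 0" "left_op p (e E1) = \<alpha> *s right_op p (e E1)" for \<alpha> p
    using that unfolding ratios_def by blast
  note s = vec_eq_iff all_gen right_op_nth left_op_nth e_nth
  have mem: "\<alpha> \<in> ratios (L35 \<alpha>)" "-1 \<in> ratios L36" "0 \<in> ratios L37" "\<alpha> \<in> ratios (L38 \<alpha>)"
    "-1 \<in> ratios L39" "0 \<in> ratios L40" for \<alpha>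
    by (rule e1; simp add: s)+
  have minus_one: "\<alpha> = -1" if "- z = \<alpha> * z" "z \<noteq> 0" for \<alpha> z :: complex
    using that by (metis mult_cancel_right mult_minus1)
  have "ratios p \<subseteq> (case p of L35 \<alpha> \<Rightarrow> {\<alpha>} | L36 \<Rightarrow> {-1} | L37 \<Rightarrow> {0}
     | L38 \<alpha> \<Rightarrow> {\<alpha>} | L39 \<Rightarrow> {-1} | L40 \<Rightarrow> {0} | _ \<Rightarrow> {})"
    by (cases p) (auto simp: ratios_def s dest: minus_one)
  then show ?thesis
    using mem by (cases p) auto
qed

lemma square_removable_iff:
  "square_removable p \<longleftrightarrow> (case p of L24 _ \<Rightarrow> False | L25 _ \<Rightarrow> False | L26 _ \<Rightarrow> False | L30 \<Rightarrow> False
     | L33 \<Rightarrow> False | L36 \<Rightarrow> False | L37 \<Rightarrow> False | L39 \<Rightarrow> False | L40 \<Rightarrow> False | _ \<Rightarrow> True)"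
proof -
  have "square_removable p" if "mult_table p (X, X) = 0"
    using that unfolding square_removable_def
    by (intro exI[of _ 0]) (simp add: vec_eq_iff sum_op_nth left_op_nth right_op_nth)
  then show ?thesis
    by (cases p) (auto simp: square_removable_def vec_eq_iff all_gen sum_op_nth left_op_nth right_op_nth e_nth)
qed

lemma diagonal_no_jordan_block:
  assumes "\<And>w k. U w $ k = d k * w $ k"
  shows "\<not> has_jordan_block U"
proof -
  have "shift_op U s w $ k = (d k - s) * w $ k" for s w k
    by (simp add: shift_op_nth assms algebra_simps)
  then show ?thesis by (auto simp: has_jordan_block_def vec_eq_iff)
qed

lemma has_jordan_blockI:
  assumes "shift_op U s (shift_op U s (e i)) = 0" "shift_op U s (e i) \<noteq> 0"
  shows "has_jordan_block U"
  using assms unfolding has_jordan_block_def by blast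

lemma has_jordan_block_left_op_iff:
  "has_jordan_block (left_op p) \<longleftrightarrow> (case p of L27 \<Rightarrow> True | L28 \<Rightarrow> True | L29 _ \<Rightarrow> True | L30 \<Rightarrow> True
     | L31 _ \<Rightarrow> True | L35 \<alpha> \<Rightarrow> \<alpha> \<noteq> 0 | L36 \<Rightarrow> True | L38 \<alpha> \<Rightarrow> \<alpha> \<noteq> 0 | L39 \<Rightarrow> True | L42 \<Rightarrow> True
     | _ \<Rightarrow> False)"
proof -
  note s = vec_eq_iff all_gen shift_op_nth left_op_nth e_nth
  have diag: "\<not> has_jordan_block (left_op p)"
    if "\<forall>w k. left_op p w $ k = mult_table p (X, k) $ k * w $ k"
    using that by (intro diagonal_no_jordan_block) blast
  have "has_jordan_block (left_op L27)" "has_jordan_block (left_op L28)"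
    by (rule has_jordan_blockI[of _ 0 E2]; simp add: s)+
  moreover have "has_jordan_block (left_op (L29 \<mu>))" "has_jordan_block (left_op L30)" "has_jordan_block (left_op (L31 \<mu>))" for \<mu>
    by (rule has_jordan_blockI[of _ "-1" E1]; simp add: s)+
  moreover have "\<alpha> \<noteq> 0 \<Longrightarrow> has_jordan_block (left_op (L35 \<alpha>))" "\<alpha> \<noteq> 0 \<Longrightarrow> has_jordan_block (left_op (L38 \<alpha>))"
    "has_jordan_block (left_op L36)" "has_jordan_block (left_op L39)" for \<alpha>
    by (rule has_jordan_blockI[of _ 0 E1]; simp add: s)+
  moreover have "has_jordan_block (left_op L42)"
    by (rule has_jordan_blockI[of _ "-1" E2]; simp add: s)
  ultimately show ?thesis
    using diag by (cases p) (auto simp: all_gen left_op_nth e_nth)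
qed

lemma has_jordan_block_right_op_iff:
  "has_jordan_block (right_op p) \<longleftrightarrow> (case p of L29 _ \<Rightarrow> True | L30 \<Rightarrow> True | L31 _ \<Rightarrow> True
     | L32 _ \<Rightarrow> True | L33 \<Rightarrow> True | L34 _ \<Rightarrow> True | L35 _ \<Rightarrow> True | L36 \<Rightarrow> True | L37 \<Rightarrow> True
     | L38 _ \<Rightarrow> True | L39 \<Rightarrow> True | L40 \<Rightarrow> True | L41 \<Rightarrow> True | L42 \<Rightarrow> True | _ \<Rightarrow> False)"
proof -
  note s = vec_eq_iff all_gen shift_op_nth right_op_nth e_nth
  have diag: "\<not> has_jordan_block (right_op p)"
    if "\<forall>w k. right_op p w $ k = mult_table p (k, X) $ k * w $ k"
    using that by (intro diagonal_no_jordan_block) blast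
  have "has_jordan_block (right_op (L29 \<mu>))" "has_jordan_block (right_op L30)" "has_jordan_block (right_op (L31 \<mu>))"
    "has_jordan_block (right_op (L32 \<mu>))" "has_jordan_block (right_op L33)" "has_jordan_block (right_op (L34 \<mu>))" for \<mu>
    by (rule has_jordan_blockI[of _ 1 E1]; simp add: s)+
  moreover have "has_jordan_block (right_op (L35 \<mu>))" "has_jordan_block (right_op L36)" "has_jordan_block (right_op L37)"
    "has_jordan_block (right_op (L38 \<mu>))" "has_jordan_block (right_op L39)" "has_jordan_block (right_op L40)" for \<mu>
    by (rule has_jordan_blockI[of _ 0 E1]; simp add: s)+
  moreover have "has_jordan_block (right_op L41)" "has_jordan_block (right_op L42)"
    by (rule has_jordan_blockI[of _ 1 E2]; simp add: s)+
  ultimately show ?thesis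
    using diag by (cases p) (auto simp: all_gen right_op_nth e_nth)
qed

lemma double_root_annihilates_cases:
  "double_root_annihilates (L31 1)" "double_root_annihilates (L32 1)" "\<not> double_root_annihilates L41" "\<not> double_root_annihilates L42"
proof -
  note s = vec_eq_iff all_gen shift_op_nth right_op_nth e_nth
  show "double_root_annihilates (L31 1)" "double_root_annihilates (L32 1)"
    unfolding double_root_annihilates_def by (rule exI[of _ 1]; simp add: s)+
  have "False" if "p = L41 \<or> p = L42" "double_root_annihilates p" for p
  proof -
    obtain s where z: "\<And>w. right_op p (shift_op (right_op p) s (shift_op (right_op p) s w)) = 0"
      using \<open>double_root_annihilates p\<close> by (auto simp: double_root_annihilates_def)
    show False using that(1) z[of "e E1"] by (elim disjE) (auto simp: s)
  qed
  then show "\<not> double_root_annihilates L41" "\<not> double_root_annihilates L42" by blast+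
qed

lemma diag_mset_left_op: "diag_mset (left_op p) = {#mult_table p (X, E1) $ E1, mult_table p (X, E2) $ E2, mult_table p (X, E3) $ E3#}"
  by (simp add: diag_mset_def left_op_nth e_nth)

lemma diag_mset_sum_op: "diag_mset (sum_op p) = {#mult_table p (X, E1) $ E1 + mult_table p (E1, X) $ E1,
    mult_table p (X, E2) $ E2 + mult_table p (E2, X) $ E2, mult_table p (X, E3) $ E3 + mult_table p (E3, X) $ E3#}"
  by (simp add: diag_mset_def sum_op_nth right_op_nth left_op_nth e_nth)

lemma isomorphic_invariants:
  assumes "isomorphic_algebras (*s) (tab p) (*s) (tab q)"
  obtains t where "t \<noteq> 0" "diag_mset (left_op q) = image_mset ((*) t) (diag_mset (left_op p))"
      "diag_mset (sum_op q) = image_mset ((*) t) (diag_mset (sum_op p))"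
    and "ratios q = ratios p"
    and "has_jordan_block (left_op q) = has_jordan_block (left_op p)" "has_jordan_block (right_op q) = has_jordan_block (right_op p)"
    and "square_removable q = square_removable p" "double_root_annihilates q = double_root_annihilates p"
proof -
  note mono = isomorphic_invariants_mono[OF assms]
    and mono' = isomorphic_invariants_mono[OF isomorphic_algebras_sym[OF assms]]
  obtain t where t: "t \<noteq> 0" "diag_mset (left_op q) = image_mset ((*) t) (diag_mset (left_op p))"
      "diag_mset (sum_op q) = image_mset ((*) t) (diag_mset (sum_op p))"
    using mono'(1) by blast
  show thesis
  proof (rule that[OF t])
    show "ratios q = ratios p" using mono(2) mono'(2) by (rule subset_antisym[rotated])
    show "has_jordan_block (left_op q) = has_jordan_block (left_op p)" using mono(3) mono'(3) by (rule iffI[rotated])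
    show "has_jordan_block (right_op q) = has_jordan_block (right_op p)" using mono(4) mono'(4) by (rule iffI[rotated])
    show "square_removable q = square_removable p" using mono(5) mono'(5) by (rule iffI[rotated])
    show "double_root_annihilates q = double_root_annihilates p" using mono(6) mono'(6) by (rule iffI[rotated])
  qed
qed

section \<open>Isomorphic tables have the same parameters\<close>

lemma mset3_eq_iff:
  "{#a', b', c'#} = {#a, b, c#} \<longleftrightarrow>
     a' = a \<and> (b' = b \<and> c' = c \<or> b' = c \<and> c' = b) \<or>
     a' = b \<and> (b' = a \<and> c' = c \<or> b' = c \<and> c' = a) \<or>
     a' = c \<and> (b' = a \<and> c' = b \<or> b' = b \<and> c' = a)"
  by (auto simp: add_eq_conv_ex)

lemma mset2_eq_iff:
  "{#a', b'#} = {#a, b#} \<longleftrightarrow> a' = a \<and> b' = b \<or> a' = b \<and> b' = a"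
  by (auto simp: add_eq_conv_ex)

text \<open>
  Jordan blocks, ratios and removability of the square cut the families into groups of at most four,
  such as \<open>L20\<close> to \<open>L23\<close> (\<open>D\<close> and \<open>A\<close> diagonalisable, removable square). Inside a group the eigenvalues
  of \<open>A\<close> and \<open>B\<close>, scaled by a common \<open>t\<close>, separate the families, with the exception of \<open>L41\<close> and \<open>L42\<close>,
  which share all eigenvalues with \<open>L32\<close> and \<open>L31\<close> at parameter \<open>1\<close> and differ from them in the size of
  the block. Within a family the scaled multisets amount to \<open>same_params\<close>, together with the ratio for
  \<open>L35\<close> and \<open>L38\<close>.
\<close>

lemma isomorphic_tables_same_params:
  assumes iso: "isomorphic_algebras (*s) (tab p) (*s) (tab q)"
    and adm: "admissible p" "admissible q"
  shows "same_params p q"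
proof -
  obtain t where t: "t \<noteq> 0" and L: "diag_mset (left_op q) = image_mset ((*) t) (diag_mset (left_op p))"
      and B: "diag_mset (sum_op q) = image_mset ((*) t) (diag_mset (sum_op p))"
    and r: "ratios q = ratios p"
    and nL: "has_jordan_block (left_op q) = has_jordan_block (left_op p)" and nR: "has_jordan_block (right_op q) = has_jordan_block (right_op p)"
    and sq: "square_removable q = square_removable p" and dr: "double_root_annihilates q = double_root_annihilates p"
    by (rule isomorphic_invariants[OF iso])
  note LB = L[unfolded diag_mset_left_op] B[unfolded diag_mset_sum_op]
  note discrete = r[unfolded ratios_eq] nL[unfolded has_jordan_block_left_op_iff]
    nR[unfolded has_jordan_block_right_op_iff] sq[unfolded square_removable_iff]
  show ?thesis
  proof (cases p)
    case (L20 m n)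
    then consider m' n' where "q = L20 m' n'" | m' n' where "q = L21 m' n'" | m' n' where "q = L22 m' n'" | m' n' where "q = L23 m' n'"
      using discrete by (cases q) auto
    then show ?thesis
      using LB adm t L20 by cases (auto simp: mset3_eq_iff mset2_eq_iff e_nth intro!: same_params.L20[where t = t])
  next
    case (L21 m n)
    then consider m' n' where "q = L20 m' n'" | m' n' where "q = L21 m' n'" | m' n' where "q = L22 m' n'" | m' n' where "q = L23 m' n'"
      using discrete by (cases q) auto
    then show ?thesis
      using LB adm t L21 by cases (auto simp: mset3_eq_iff mset2_eq_iff e_nth intro!: same_params.L21[where t = t])
  next
    case (L22 m n)
    then consider m' n' where "q = L20 m' n'" | m' n' where "q = L21 m' n'" | m' n' where "q = L22 m' n'" | m' n' where "q = L23 m' n'"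
      using discrete by (cases q) auto
    then show ?thesis
      using LB adm t L22 by cases (auto simp: mset3_eq_iff mset2_eq_iff e_nth intro: same_params.refl same_params.L22)
  next
    case (L23 m n)
    then consider m' n' where "q = L20 m' n'" | m' n' where "q = L21 m' n'" | m' n' where "q = L22 m' n'" | m' n' where "q = L23 m' n'"
      using discrete by (cases q) auto
    then show ?thesis
      using LB adm t L23 by cases (auto simp: mset3_eq_iff mset2_eq_iff e_nth intro!: same_params.L23[where t = t])
  next
    case (L24 m)
    then consider m' where "q = L24 m'" | m' where "q = L25 m'" | m' where "q = L26 m'"
      using discrete by (cases q) auto
    then show ?thesis
      using LB adm t L24 by cases (auto simp: mset3_eq_iff mset2_eq_iff e_nth intro!: same_params.L24[where t = t])
  next
    case (L25 m)
    then consider m' where "q = L24 m'" | m' where "q = L25 m'" | m' where "q = L26 m'"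
      using discrete by (cases q) auto
    then show ?thesis
      using LB adm t L25 by cases (auto simp: mset3_eq_iff mset2_eq_iff e_nth intro: same_params.intros)
  next
    case (L26 m)
    then consider m' where "q = L24 m'" | m' where "q = L25 m'" | m' where "q = L26 m'"
      using discrete by (cases q) auto
    then show ?thesis
      using LB adm t L26 by cases (auto simp: mset3_eq_iff mset2_eq_iff e_nth intro!: same_params.L26[where t = t])
  next
    case L27
    then consider "q = L27" | "q = L28"
      using discrete by (cases q) auto
    then show ?thesis
      using LB adm t L27 by cases (auto simp: mset3_eq_iff mset2_eq_iff e_nth intro: same_params.intros)
  next
    case L28
    then consider "q = L27" | "q = L28"
      using discrete by (cases q) auto
    then show ?thesis
      using LB adm t L28 by cases (auto simp: mset3_eq_iff mset2_eq_iff e_nth intro: same_params.intros)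
  next
    case (L29 m)
    then consider m' where "q = L29 m'" | m' where "q = L31 m'" | "q = L42"
      using discrete by (cases q) auto
    then show ?thesis
      using LB adm t L29 by cases (auto simp: mset3_eq_iff mset2_eq_iff e_nth intro: same_params.intros)
  next
    case L30
    then have "q = L30"
      using discrete by (cases q) auto
    then show ?thesis using L30 by (simp add: same_params.refl)
  next
    case (L31 m)
    then consider m' where "q = L29 m'" | m' where "q = L31 m'" | "q = L42"
      using discrete by (cases q) auto
    then show ?thesis
      using LB adm t L31 dr double_root_annihilates_cases by cases (auto simp: mset3_eq_iff mset2_eq_iff e_nth intro: same_params.intros)
  next
    case (L32 m)
    then consider m' where "q = L32 m'" | m' where "q = L34 m'" | "q = L41"
      using discrete by (cases q) auto
    then show ?thesis
      using LB adm t L32 dr double_root_annihilates_cases by cases (auto simp: mset3_eq_iff mset2_eq_iff e_nth intro: same_params.intros)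
  next
    case L33
    then have "q = L33"
      using discrete by (cases q) auto
    then show ?thesis using L33 by (simp add: same_params.refl)
  next
    case (L34 m)
    then consider m' where "q = L32 m'" | m' where "q = L34 m'" | "q = L41"
      using discrete by (cases q) auto
    then show ?thesis
      using LB adm t L34 by cases (auto simp: mset3_eq_iff mset2_eq_iff e_nth intro: same_params.intros)
  next
    case (L35 m)
    then consider m' where "q = L35 m'" | m' where "q = L38 m'"
      using discrete by (cases q) auto
    then show ?thesis
      using LB adm t L35 r[unfolded ratios_eq] by cases (auto simp: mset3_eq_iff mset2_eq_iff e_nth intro: same_params.intros)
  next
    case L36
    then consider "q = L36" | "q = L39"
      using discrete by (cases q) auto
    then show ?thesis
      using LB adm t L36 by cases (auto simp: mset3_eq_iff mset2_eq_iff e_nth intro: same_params.intros)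
  next
    case L37
    then consider "q = L37" | "q = L40"
      using discrete by (cases q) auto
    then show ?thesis
      using LB adm t L37 by cases (auto simp: mset3_eq_iff mset2_eq_iff e_nth intro: same_params.intros)
  next
    case (L38 m)
    then consider m' where "q = L35 m'" | m' where "q = L38 m'"
      using discrete by (cases q) auto
    then show ?thesis
      using LB adm t L38 r[unfolded ratios_eq] by cases (auto simp: mset3_eq_iff mset2_eq_iff e_nth intro: same_params.intros)
  next
    case L39
    then consider "q = L36" | "q = L39"
      using discrete by (cases q) auto
    then show ?thesis
      using LB adm t L39 by cases (auto simp: mset3_eq_iff mset2_eq_iff e_nth intro: same_params.intros)
  next
    case L40
    then consider "q = L37" | "q = L40"
      using discrete by (cases q) auto
    then show ?thesis
      using LB adm t L40 by cases (auto simp: mset3_eq_iff mset2_eq_iff e_nth intro: same_params.intros)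
  next
    case L41
    then consider m' where "q = L32 m'" | m' where "q = L34 m'" | "q = L41"
      using discrete by (cases q) auto
    then show ?thesis
      using LB adm t L41 dr double_root_annihilates_cases by cases (auto simp: mset3_eq_iff mset2_eq_iff e_nth intro: same_params.intros)
  next
    case L42
    then consider m' where "q = L29 m'" | m' where "q = L31 m'" | "q = L42"
      using discrete by (cases q) auto
    then show ?thesis
      using LB adm t L42 dr double_root_annihilates_cases by cases (auto simp: mset3_eq_iff mset2_eq_iff e_nth intro: same_params.intros)
  qed
qed

theorem proposition3p11:
  shows "(\<forall>(scale :: complex \<Rightarrow> 'a::ab_group_add \<Rightarrow> 'a) bracket.
           leibniz_algebra scale bracket \<and>
           vector_space.dim scale (UNIV :: 'a set) = 4 \<and>
           leibniz_algebra.solvable scale bracket \<and>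
           (\<exists>N. leibniz_algebra.is_nilradical scale bracket N \<and>
                vector_space.dim scale N = 3 \<and>
                leibniz_algebra.abelian_set bracket N) \<longrightarrow>
           (\<exists>p. admissible p \<and>
                isomorphic_algebras scale bracket (*s) (table_bracket (mult_table p)))) \<and>
         (\<forall>p q. admissible p \<and> admissible q \<and> \<not> same_params p q \<longrightarrow>
           \<not> isomorphic_algebras (*s) (table_bracket (mult_table p))
                                  (*s) (table_bracket (mult_table q)))"
proof (intro conjI allI impI; elim conjE exE)
  fix scale :: "complex \<Rightarrow> 'a \<Rightarrow> 'a" and bracket N
  assume "leibniz_algebra scale bracket" "vector_space.dim scale (UNIV :: 'a set) = 4"
    "leibniz_algebra.is_nilradical scale bracket N" "vector_space.dim scale N = 3"
    "leibniz_algebra.abelian_set bracket N"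
  then show "\<exists>p. admissible p \<and>
      isomorphic_algebras scale bracket (*s) (table_bracket (mult_table p))"
    by (rule classification)
next
  fix p q
  assume "admissible p" "admissible q" "\<not> same_params p q"
  then show "\<not> isomorphic_algebras (*s) (table_bracket (mult_table p))
                                 (*s) (table_bracket (mult_table q))"
    using isomorphic_tables_same_params by blast
qed

end
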